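(* Let $a:\mathbb{N}\to\mathbb{C}$ with $a(1)\ne 0$, and suppose that the Dirichlet series $Z(s)=\sum_{n=1}^\infty a(n)n^{-s}$ converges absolutely for $\sigma=\Re(s)>1$. Let $A(n)=(a^{\#}*a^{-1})(n)$, where $a^{\#}(n)=a(n)\log n$ and $a^{-1}$ is the Dirichlet inverse of $a$. If $\sigma_0\ge 1$ and $Z(s)\ne 0$ for all $s$ with $\sigma>\sigma_0$, then for $\sigma>\sigma_0$, $$Z(s)=\exp\bigl(G(s)\bigr),\qquad G(s):=\log a(1)+\sum_{n=2}^\infty\frac{A(n)}{\log n}n^{-s}.$$ Here the Dirichlet series $\sum_{n=2}^\infty \frac{A(n)}{\log n}n^{-s}$ converges uniformly on every compact subset of the half-plane $\sigma>\sigma_0$. Furthermore, the series for $G(s)$ converges absolutely when $\sigma>1+\sigma_0$.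
   Context: Dirichlet convolution: $(a*b)(n)=\sum_{d\mid n}a(d)\,b(n/d)$. If $a(1)\ne0$, the Dirichlet inverse $a^{-1}$ is the unique arithmetic function with $(a*a^{-1})(1)=1$ and $(a*a^{-1})(n)=0$ for $n>1$. For complex $z\ne0$, $\log z$ denotes the branch of the logarithm which is real when $z>0$. *)

theory Defs
  imports "HOL-Analysis.Analysis"
begin

text \<open>
  Arithmetic functions are functions on \<^typ>\<open>nat\<close> whose value at 0 is irrelevant: below they
  are only ever evaluated at positive arguments. At \<open>n = 0\<close> the convolution is a sum over an
  infinite set, hence 0.
\<close>

definition dirichlet_conv :: "(nat \<Rightarrow> complex) \<Rightarrow> (nat \<Rightarrow> complex) \<Rightarrow> nat \<Rightarrow> complex" where
  "dirichlet_conv a b n = (\<Sum>d | d dvd n. a d * b (n div d))"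

text \<open>The condition \<open>b 0 = 0\<close> only fixes the irrelevant value, so that the inverse is unique.\<close>

definition is_dirichlet_inverse :: "(nat \<Rightarrow> complex) \<Rightarrow> (nat \<Rightarrow> complex) \<Rightarrow> bool" where
  "is_dirichlet_inverse a b \<longleftrightarrow>
     b 0 = 0 \<and> dirichlet_conv a b 1 = 1 \<and> (\<forall>n>1. dirichlet_conv a b n = 0)"

definition dirichlet_inverse :: "(nat \<Rightarrow> complex) \<Rightarrow> nat \<Rightarrow> complex" where
  "dirichlet_inverse a = (THE b. is_dirichlet_inverse a b)"

lemma dirichlet_conv_rec:
  assumes "n > 0"
  shows "dirichlet_conv a b n =
           a 1 * b n + (\<Sum>d | d dvd n \<and> d \<noteq> 1. a d * b (n div d))"
proof -
  have "{d. d dvd n} = insert 1 {d. d dvd n \<and> d \<noteq> 1}" by auto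
  moreover have "finite {d. d dvd n \<and> d \<noteq> 1}"
    using assms by (intro finite_subset[OF _ finite_divisors_nat[of n]]) auto
  ultimately show ?thesis by (simp add: dirichlet_conv_def)
qed

lemma div_proper_less_nat:
  fixes d n :: nat
  assumes "n > 0" "d dvd n" "d \<noteq> 1"
  shows "n div d < n"
proof -
  have "d > 1" using assms by (cases d) auto
  then show ?thesis using assms(1) by simp
qed

function dirichlet_inverse_rec :: "(nat \<Rightarrow> complex) \<Rightarrow> nat \<Rightarrow> complex" where
  "dirichlet_inverse_rec a n =
     (if n = 0 then 0 else
        ((if n = 1 then 1 else 0)
         - (\<Sum>d | d dvd n \<and> d \<noteq> 1. a d * dirichlet_inverse_rec a (n div d))) / a 1)"
  by pat_completeness auto
termination
  by (relation "Wellfounded.measure snd") (auto intro: div_proper_less_nat[simplified])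

declare dirichlet_inverse_rec.simps [simp del]

lemma dirichlet_inverse_ex1:
  assumes "a 1 \<noteq> 0"
  shows "\<exists>!b. is_dirichlet_inverse a b"
proof (rule ex1I)
  have "dirichlet_conv a (dirichlet_inverse_rec a) n = (if n = 1 then 1 else 0)" if "n > 0" for n
    using that assms
    by (subst dirichlet_conv_rec[OF that], subst (1) dirichlet_inverse_rec.simps) simp
  moreover have "dirichlet_inverse_rec a 0 = 0"
    by (simp add: dirichlet_inverse_rec.simps)
  ultimately show "is_dirichlet_inverse a (dirichlet_inverse_rec a)"
    by (simp add: is_dirichlet_inverse_def)
next
  fix b assume b: "is_dirichlet_inverse a b"
  have "b n = dirichlet_inverse_rec a n" for n
  proof (induction n rule: less_induct)
    case (less n)
    show ?case
    proof (cases "n = 0")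
      case True
      then show ?thesis using b by (simp add: is_dirichlet_inverse_def dirichlet_inverse_rec.simps)
    next
      case False
      have "dirichlet_conv a b n = (if n = 1 then 1 else 0)"
        using b False by (auto simp: is_dirichlet_inverse_def)
      moreover have "(\<Sum>d | d dvd n \<and> d \<noteq> 1. a d * b (n div d)) =
          (\<Sum>d | d dvd n \<and> d \<noteq> 1. a d * dirichlet_inverse_rec a (n div d))"
        using False by (intro sum.cong refl) (auto intro!: less.IH div_proper_less_nat[simplified])
      ultimately have "a 1 * b n = (if n = 1 then 1 else 0) -
          (\<Sum>d | d dvd n \<and> d \<noteq> 1. a d * dirichlet_inverse_rec a (n div d))"
        using False by (simp add: dirichlet_conv_rec algebra_simps)
      then show ?thesis
        using False assms by (subst dirichlet_inverse_rec.simps) (simp add: field_simps)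
    qed
  qed
  then show "b = dirichlet_inverse_rec a" by blast
qed

definition dirichlet_term :: "(nat \<Rightarrow> complex) \<Rightarrow> complex \<Rightarrow> nat \<Rightarrow> complex" where
  "dirichlet_term a s n = a n * of_nat n powr (- s)"

text \<open>The sum runs over \<open>n \<ge> 1\<close>, in increasing order.\<close>

definition dirichlet_series :: "(nat \<Rightarrow> complex) \<Rightarrow> complex \<Rightarrow> complex" where
  "dirichlet_series a s = (\<Sum>n. dirichlet_term a s (n + 1))"

definition log_coeff :: "(nat \<Rightarrow> complex) \<Rightarrow> nat \<Rightarrow> complex" where
  "log_coeff a = dirichlet_conv (\<lambda>n. a n * of_real (ln (real n))) (dirichlet_inverse a)"

definition G_coeff :: "(nat \<Rightarrow> complex) \<Rightarrow> nat \<Rightarrow> complex" where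
  "G_coeff a n = log_coeff a n / of_real (ln (real n))"

text \<open>\<open>Ln\<close> is the principal branch, with imaginary part in \<open>(-\<pi>, \<pi>]\<close>.\<close>

definition dirichlet_G :: "(nat \<Rightarrow> complex) \<Rightarrow> complex \<Rightarrow> complex" where
  "dirichlet_G a s = Ln (a 1) + (\<Sum>n. dirichlet_term (G_coeff a) s (n + 2))"

end

theory Submission
  imports Defs "HOL-Complex_Analysis.Complex_Analysis"
begin

text \<open>
  The point of the theorem is that the series for $G$ converges in the whole half-plane
  $\sigma > \sigma_0$ in which $Z$ has no zeros. The proof shows that it even converges absolutely
  there. Since $A = a^{\#} * a^{-1}$, and the series of $a^{\#}$ (that is, $-Z'$) converges
  absolutely for $\sigma > 1$, it suffices to show that the series of $a^{-1}$, which formally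
  represents $1/Z$, converges absolutely for $\sigma > \sigma_0$. This is done in two steps.

  First, $|Z|$ is bounded below by a positive constant on every half-plane $\sigma \ge x$ with
  $x > \sigma_0$. This is a normal family argument with the vertical translates of $Z$
  (\<open>dirichlet_sum_bounded_below\<close>).

  Second, an absolutely convergent Dirichlet series that is bounded away from 0 on a half-plane has
  an inverse whose series converges absolutely in every smaller half-plane
  (\<open>abs_conv_at_inverse_if_bounded_below\<close>). This is a version of Wiener's lemma, and the proof follows
  the idea of D. J. Newman's short proof of Wiener's theorem: approximate $Z$ by a Dirichlet
  polynomial $P$ and expand $1/Z$ into a geometric series in $(P - Z)/P$. The norms of the powers of
  $1/P$ can be estimated because $P$ involves only finitely many primes: the coefficients of $1/P^j$
  are controlled by the supremum of $|1/P|^j$ (\<open>dirichlet_coeff_bound\<close>), and the integers composed of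
  finitely many primes are so sparse that a bound for the coefficients is as good as a
  bound for the norm (\<open>abs_conv_at_prime_factors_in\<close>).

  Once the series for $G$ is known to converge absolutely, $Z e^{-G}$ has derivative 0, and its
  value is found by letting $\sigma \to \infty$ (\<open>dirichlet_sum_eq_exp\<close>). Uniform convergence on compact
  sets follows from the Weierstrass test.
\<close>

section \<open>The ring of arithmetic functions\<close>

lemma dirichlet_conv_0 [simp]: "dirichlet_conv f g 0 = 0"
  by (simp add: dirichlet_conv_def)

lemma dirichlet_conv_1 [simp]: "dirichlet_conv f g (Suc 0) = f 1 * g 1"
  by (simp add: dirichlet_conv_def)

lemma dirichlet_conv_commute: "dirichlet_conv f g = dirichlet_conv g f"
proof
  fix n
  show "dirichlet_conv f g n = dirichlet_conv g f n"
  proof (cases "n = 0")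
    case False
    then show ?thesis unfolding dirichlet_conv_def
      by (intro sum.reindex_bij_witness[of _ "\<lambda>d. n div d" "\<lambda>d. n div d"]) (auto elim!: dvdE)
  qed simp
qed

lemma dirichlet_conv_assoc:
  "dirichlet_conv (dirichlet_conv f g) h = dirichlet_conv f (dirichlet_conv g h)"
proof
  fix n
  show "dirichlet_conv (dirichlet_conv f g) h n = dirichlet_conv f (dirichlet_conv g h) n"
  proof (cases "n = 0")
    case False
    then have fin: "finite {d. d dvd n}" and fin': "\<And>x. x dvd n \<Longrightarrow> finite {d. d dvd x}"
      by (auto simp: finite_divisors_nat intro!: finite_divisors_nat)
    have "dirichlet_conv (dirichlet_conv f g) h n =
        (\<Sum>d | d dvd n. \<Sum>x | x dvd d. f x * g (d div x) * h (n div d))"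
      by (simp add: dirichlet_conv_def sum_distrib_right)
    also have "\<dots> = (\<Sum>(d, x)\<in>(SIGMA d:{d. d dvd n}. {x. x dvd d}). f x * g (d div x) * h (n div d))"
      using fin fin' by (subst sum.Sigma) auto
    also have "\<dots> = (\<Sum>(x, y)\<in>(SIGMA x:{x. x dvd n}. {y. y dvd n div x}). f x * (g y * h (n div x div y)))"
      using False
      by (intro sum.reindex_bij_witness[of _ "\<lambda>(x, y). (x * y, x)" "\<lambda>(d, x). (x, d div x)"])
         (auto elim!: dvdE simp: div_mult2_eq)
    also have "\<dots> = (\<Sum>x | x dvd n. \<Sum>y | y dvd n div x. f x * (g y * h (n div x div y)))"
      using fin False by (subst sum.Sigma) (auto intro!: finite_divisors_nat elim!: dvdE)
    also have "\<dots> = dirichlet_conv f (dirichlet_conv g h) n"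
      by (simp add: dirichlet_conv_def sum_distrib_left)
    finally show ?thesis .
  qed simp
qed

lemma dirichlet_conv_left_commute:
  "dirichlet_conv f (dirichlet_conv g h) = dirichlet_conv g (dirichlet_conv f h)"
  by (metis dirichlet_conv_assoc dirichlet_conv_commute)

lemmas dirichlet_conv_ac =
  dirichlet_conv_assoc dirichlet_conv_commute dirichlet_conv_left_commute

lemma dirichlet_conv_diff_right:
  "dirichlet_conv f (\<lambda>n. g n - h n) n = dirichlet_conv f g n - dirichlet_conv f h n"
  by (simp add: dirichlet_conv_def algebra_simps sum_subtractf)

lemma dirichlet_conv_add_left:
  "dirichlet_conv (\<lambda>n. f n + g n) h n = dirichlet_conv f h n + dirichlet_conv g h n"
  by (simp add: dirichlet_conv_def algebra_simps sum.distrib)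

lemma dirichlet_conv_cmult_right:
  "dirichlet_conv f (\<lambda>n. c * g n) n = c * dirichlet_conv f g n"
  by (simp add: dirichlet_conv_def algebra_simps sum_distrib_left)

lemma dirichlet_conv_sum_right:
  "dirichlet_conv f (\<lambda>n. \<Sum>k\<in>K. g k n) n = (\<Sum>k\<in>K. dirichlet_conv f (g k) n)"
  unfolding dirichlet_conv_def sum_distrib_left by (rule sum.swap)

definition dirichlet_unit :: "nat \<Rightarrow> complex" where
  "dirichlet_unit n = (if n = 1 then 1 else 0)"

lemma dirichlet_conv_unit_right:
  assumes "f 0 = 0"
  shows "dirichlet_conv f dirichlet_unit = f"
proof
  fix n
  show "dirichlet_conv f dirichlet_unit n = f n"
  proof (cases "n = 0")
    case False
    have "dirichlet_conv f dirichlet_unit n = (\<Sum>d | d dvd n. if d = n then f d else 0)"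
      unfolding dirichlet_conv_def dirichlet_unit_def
      using False by (intro sum.cong) (auto elim!: dvdE)
    also have "\<dots> = f n"
      using False by (simp add: finite_divisors_nat)
    finally show ?thesis .
  qed (use assms in simp)
qed

lemma dirichlet_inverse_props:
  assumes "a 1 \<noteq> 0"
  shows "dirichlet_inverse a 0 = 0" "dirichlet_conv a (dirichlet_inverse a) = dirichlet_unit"
proof -
  have *: "is_dirichlet_inverse a (dirichlet_inverse a)"
    using theI'[OF dirichlet_inverse_ex1[of a, OF assms]] by (simp add: dirichlet_inverse_def)
  show "dirichlet_inverse a 0 = 0" using * by (simp add: is_dirichlet_inverse_def)
  show "dirichlet_conv a (dirichlet_inverse a) = dirichlet_unit"
  proof
    fix n
    show "dirichlet_conv a (dirichlet_inverse a) n = dirichlet_unit n"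
      using * by (cases "n = 0"; cases "n = 1") (auto simp: is_dirichlet_inverse_def dirichlet_unit_def)
  qed
qed

primrec dirichlet_power :: "(nat \<Rightarrow> complex) \<Rightarrow> nat \<Rightarrow> nat \<Rightarrow> complex" where
  "dirichlet_power f 0 = dirichlet_unit"
| "dirichlet_power f (Suc k) = dirichlet_conv f (dirichlet_power f k)"

section \<open>Absolutely convergent Dirichlet series\<close>

lemma dirichlet_term_0 [simp]: "dirichlet_term f s 0 = 0"
  by (simp add: dirichlet_term_def)

lemma norm_dirichlet_term: "norm (dirichlet_term f s n) = norm (f n) * real n powr (- Re s)"
  by (cases "n = 0") (auto simp: dirichlet_term_def norm_mult norm_powr_real_powr)

text \<open>
  Multiplying the coefficients by $n^{-s}$ is compatible with Dirichlet convolution because $n^{-s}$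
  is completely multiplicative. Statements about convolutions of Dirichlet series thereby reduce to
  statements about convolutions of absolutely summable sequences.
\<close>

lemma dirichlet_term_conv:
  "dirichlet_term (dirichlet_conv f g) s = dirichlet_conv (dirichlet_term f s) (dirichlet_term g s)"
proof
  fix n
  show "dirichlet_term (dirichlet_conv f g) s n = dirichlet_conv (dirichlet_term f s) (dirichlet_term g s) n"
  proof (cases "n = 0")
    case False
    have *: "(of_nat n :: complex) powr - s = of_nat d powr - s * of_nat (n div d) powr - s"
      if "d dvd n" for d
    proof -
      from that obtain e where "n = d * e" by blast
      with False show ?thesis
        by (simp add: powr_times_real)
    qed
    have "dirichlet_term (dirichlet_conv f g) s n =
        (\<Sum>d | d dvd n. f d * g (n div d) * of_nat n powr - s)"
      by (simp add: dirichlet_conv_def dirichlet_term_def sum_distrib_right)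
    also have "\<dots> = (\<Sum>d | d dvd n. dirichlet_term f s d * dirichlet_term g s (n div d))"
      by (rule sum.cong) (auto simp: dirichlet_term_def *)
    finally show ?thesis
      by (simp add: dirichlet_conv_def)
  qed simp
qed


text \<open>
  Both sides sum $u(x)\,v(y)$ over all pairs of positive integers; on the left the pairs are grouped by
  their product $n = x y$. The value at 0 is left out because every number divides 0.
\<close>

lemma has_sum_divisor_sums:
  fixes u v :: "nat \<Rightarrow> 'a :: {real_normed_field, banach}"
  assumes "u 0 = 0" "v 0 = 0" and su: "summable (\<lambda>n. norm (u n))" and sv: "summable (\<lambda>n. norm (v n))"
  shows "((\<lambda>n. \<Sum>d | d dvd n. u d * v (n div d)) has_sum (\<Sum>n. u n) * (\<Sum>n. v n)) {0<..}"
proof -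
  let ?A = "{0<..} :: nat set"
  have pos: "(f has_sum (\<Sum>n. f n)) ?A" 
    if "f 0 = 0" "summable (\<lambda>n. norm (f n))" for f :: "nat \<Rightarrow> 'b :: banach"
  proof -
    have "(f has_sum (\<Sum>n. f n)) UNIV"
      using that(2) by (intro norm_summable_imp_has_sum summable_sums) (auto dest: summable_norm_cancel)
    then show ?thesis
      by (rule has_sum_cong_neutral[THEN iffD1, rotated -1]) (use that(1) in auto)
  qed
  have hu: "(u has_sum (\<Sum>n. u n)) ?A" and hv: "(v has_sum (\<Sum>n. v n)) ?A"
    using assms by (auto intro: pos)
  have nu: "((\<lambda>n. norm (u n)) has_sum (\<Sum>n. norm (u n))) ?A"
    and nv: "((\<lambda>n. norm (v n)) has_sum (\<Sum>n. norm (v n))) ?A"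
    using assms by (auto intro: pos)
  have "(\<lambda>(x, y). norm (u x * v y)) summable_on (?A \<times> ?A)"
  proof (rule summable_on_SigmaI[where g = "\<lambda>x. norm (u x) * (\<Sum>n. norm (v n))"])
    show "((\<lambda>y. case (x, y) of (x, y) \<Rightarrow> norm (u x * v y)) has_sum norm (u x) * (\<Sum>n. norm (v n))) ?A" for x
      using has_sum_cmult_right[OF nv] by (simp add: norm_mult)
    show "(\<lambda>x. norm (u x) * (\<Sum>n. norm (v n))) summable_on ?A"
      using nu by (intro summable_on_cmult_left) (auto simp: summable_on_def)
  qed auto
  then have "(\<lambda>(x, y). u x * v y) summable_on (?A \<times> ?A)"
    by - (rule abs_summable_summable, simp add: case_prod_unfold)
  then obtain S where S: "((\<lambda>(x, y). u x * v y) has_sum S) (?A \<times> ?A)"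
    by (auto simp: summable_on_def)
  have "((\<lambda>x. u x * (\<Sum>n. v n)) has_sum S) ?A"
    by (rule has_sum_SigmaD[OF S]) (use has_sum_cmult_right[OF hv] in auto)
  moreover have "((\<lambda>x. u x * (\<Sum>n. v n)) has_sum (\<Sum>n. u n) * (\<Sum>n. v n)) ?A"
    by (rule has_sum_cmult_left[OF hu])
  ultimately have S_eq: "S = (\<Sum>n. u n) * (\<Sum>n. v n)"
    by (rule has_sum_unique)
  have "((\<lambda>(n, d). u d * v (n div d)) has_sum S) (SIGMA n:?A. {d. d dvd n})
    \<longleftrightarrow> ((\<lambda>(x, y). u x * v y) has_sum S) (?A \<times> ?A)"
    by (rule has_sum_reindex_bij_witness[of _ "\<lambda>(x, y). (x * y, x)" "\<lambda>(n, d). (d, n div d)"])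
       (auto elim!: dvdE intro: Nat.gr0I)
  with S have "((\<lambda>(n, d). u d * v (n div d)) has_sum S) (SIGMA n:?A. {d. d dvd n})"
    by simp
  then have "((\<lambda>n. \<Sum>d | d dvd n. u d * v (n div d)) has_sum S) ?A"
    by (rule has_sum_SigmaD) (auto intro!: has_sum_finite finite_divisors_nat)
  then show ?thesis by (simp add: S_eq)
qed

lemma dirichlet_conv_abs_summable:
  fixes u v :: "nat \<Rightarrow> complex"
  assumes "u 0 = 0" "v 0 = 0" "summable (\<lambda>n. norm (u n))" "summable (\<lambda>n. norm (v n))"
  shows "summable (\<lambda>n. norm (dirichlet_conv u v n))"
    and "(\<Sum>n. dirichlet_conv u v n) = (\<Sum>n. u n) * (\<Sum>n. v n)"
    and "(\<Sum>n. norm (dirichlet_conv u v n)) \<le> (\<Sum>n. norm (u n)) * (\<Sum>n. norm (v n))"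
proof -
  let ?M = "\<lambda>n. \<Sum>d | d dvd n. norm (u d) * norm (v (n div d))"
  have "(?M has_sum (\<Sum>n. norm (u n)) * (\<Sum>n. norm (v n))) {0<..}"
    by (rule has_sum_divisor_sums) (use assms in auto)
  then have "(?M has_sum (\<Sum>n. norm (u n)) * (\<Sum>n. norm (v n))) UNIV"
    by (rule has_sum_cong_neutral[THEN iffD1, rotated -1]) auto
  then have M: "?M sums ((\<Sum>n. norm (u n)) * (\<Sum>n. norm (v n)))"
    by (rule has_sum_imp_sums)
  have le: "norm (dirichlet_conv u v n) \<le> ?M n" for n
    unfolding dirichlet_conv_def by (rule order_trans[OF norm_sum]) (simp add: norm_mult)
  show sm: "summable (\<lambda>n. norm (dirichlet_conv u v n))"
    by (rule summable_comparison_test'[OF sums_summable[OF M]]) (use le in auto)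
  show "(\<Sum>n. norm (dirichlet_conv u v n)) \<le> (\<Sum>n. norm (u n)) * (\<Sum>n. norm (v n))"
    using suminf_le[OF le sm sums_summable[OF M]] sums_unique[OF M] by simp
  have "(dirichlet_conv u v has_sum (\<Sum>n. u n) * (\<Sum>n. v n)) {0<..}"
    unfolding dirichlet_conv_def by (rule has_sum_divisor_sums) (use assms in auto)
  then have "(dirichlet_conv u v has_sum (\<Sum>n. u n) * (\<Sum>n. v n)) UNIV"
    by (rule has_sum_cong_neutral[THEN iffD1, rotated -1]) auto
  then show "(\<Sum>n. dirichlet_conv u v n) = (\<Sum>n. u n) * (\<Sum>n. v n)"
    using has_sum_imp_sums sums_unique by metis
qed

text \<open>
  Absolute convergence depends on the real part of the argument only, so it is recorded for real
  abscissas.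
\<close>

definition abs_conv_at :: "(nat \<Rightarrow> complex) \<Rightarrow> real \<Rightarrow> bool" where
  "abs_conv_at f x \<longleftrightarrow> summable (\<lambda>n. norm (dirichlet_term f (of_real x) n))"

definition dirichlet_norm :: "real \<Rightarrow> (nat \<Rightarrow> complex) \<Rightarrow> real" where
  "dirichlet_norm x f = (\<Sum>n. norm (dirichlet_term f (of_real x) n))"

definition dirichlet_sum :: "(nat \<Rightarrow> complex) \<Rightarrow> complex \<Rightarrow> complex" where
  "dirichlet_sum f s = (\<Sum>n. dirichlet_term f s n)"

lemma norm_dirichlet_term_mono:
  assumes "x \<le> Re s"
  shows "norm (dirichlet_term f s n) \<le> norm (dirichlet_term f (of_real x) n)"
proof (cases "n = 0")
  case False
  then have "real n powr - Re s \<le> real n powr - x"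
    using assms by (intro powr_mono) auto
  then show ?thesis
    by (simp add: norm_dirichlet_term mult_left_mono)
qed simp

lemma abs_conv_at_summable_norm:
  assumes "abs_conv_at f x" "x \<le> Re s"
  shows "summable (\<lambda>n. norm (dirichlet_term f s n))"
  by (rule summable_comparison_test'[of "\<lambda>n. norm (dirichlet_term f (of_real x) n)" 0])
     (use assms norm_dirichlet_term_mono in \<open>auto simp: abs_conv_at_def\<close>)

lemma abs_conv_at_summable:
  "abs_conv_at f x \<Longrightarrow> x \<le> Re s \<Longrightarrow> summable (dirichlet_term f s)"
  using abs_conv_at_summable_norm summable_norm_cancel by blast

lemma abs_conv_at_mono: "abs_conv_at f x \<Longrightarrow> x \<le> y \<Longrightarrow> abs_conv_at f y"
  using abs_conv_at_summable_norm[of f x "of_real y"] by (simp add: abs_conv_at_def)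

lemma dirichlet_norm_nonneg: "abs_conv_at f x \<Longrightarrow> 0 \<le> dirichlet_norm x f"
  by (simp add: abs_conv_at_def dirichlet_norm_def suminf_nonneg)

lemma dirichlet_norm_mono:
  assumes "abs_conv_at f x" "x \<le> y"
  shows "dirichlet_norm y f \<le> dirichlet_norm x f"
  unfolding dirichlet_norm_def
  by (intro suminf_le norm_dirichlet_term_mono)
     (use assms abs_conv_at_mono[OF assms] in \<open>auto simp: abs_conv_at_def\<close>)

lemma norm_dirichlet_sum_le:
  assumes "abs_conv_at f x" "x \<le> Re s"
  shows "norm (dirichlet_sum f s) \<le> dirichlet_norm x f"
proof -
  have "norm (dirichlet_sum f s) \<le> (\<Sum>n. norm (dirichlet_term f s n))"
    unfolding dirichlet_sum_def by (rule summable_norm[OF abs_conv_at_summable_norm[OF assms]])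
  also have "\<dots> \<le> dirichlet_norm x f"
    unfolding dirichlet_norm_def
    by (intro suminf_le norm_dirichlet_term_mono abs_conv_at_summable_norm[OF assms])
       (use assms in \<open>auto simp: abs_conv_at_def\<close>)
  finally show ?thesis .
qed

lemma sum_norm_dirichlet_term_le:
  assumes "abs_conv_at f x" "finite F"
  shows "(\<Sum>n\<in>F. norm (dirichlet_term f (of_real x) n)) \<le> dirichlet_norm x f"
  unfolding dirichlet_norm_def using assms by (intro sum_le_suminf) (auto simp: abs_conv_at_def)

lemma
  assumes "abs_conv_at f x" "abs_conv_at g x"
  shows abs_conv_at_conv: "abs_conv_at (dirichlet_conv f g) x"
    and dirichlet_norm_conv_le:
      "dirichlet_norm x (dirichlet_conv f g) \<le> dirichlet_norm x f * dirichlet_norm x g"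
  using dirichlet_conv_abs_summable[of "dirichlet_term f (of_real x)" "dirichlet_term g (of_real x)"] assms
  by (simp_all add: abs_conv_at_def dirichlet_norm_def dirichlet_term_conv)

lemma dirichlet_sum_conv:
  assumes "abs_conv_at f x" "abs_conv_at g x" "x \<le> Re s"
  shows "dirichlet_sum (dirichlet_conv f g) s = dirichlet_sum f s * dirichlet_sum g s"
  using dirichlet_conv_abs_summable(2)[of "dirichlet_term f s" "dirichlet_term g s"]
    abs_conv_at_summable_norm[OF assms(1,3)] abs_conv_at_summable_norm[OF assms(2,3)]
  by (simp add: dirichlet_sum_def dirichlet_term_conv)

lemma dirichlet_term_unit: "dirichlet_term dirichlet_unit s n = (if n = 1 then 1 else 0)"
  by (simp add: dirichlet_term_def dirichlet_unit_def)

lemma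
  shows abs_conv_at_unit: "abs_conv_at dirichlet_unit x"
    and dirichlet_norm_unit: "dirichlet_norm x dirichlet_unit = 1"
    and dirichlet_sum_unit: "dirichlet_sum dirichlet_unit s = 1"
proof -
  have *: "(\<lambda>n. if n = 1 then 1 else 0) sums (1 :: 'a :: real_normed_field)"
    using sums_single[of 1 "\<lambda>_. 1 :: 'a"] by simp
  have eq: "(\<lambda>n. norm (dirichlet_term dirichlet_unit s n)) = (\<lambda>n. if n = 1 then 1 else 0)" for s
    by (auto simp: dirichlet_term_unit)
  show "abs_conv_at dirichlet_unit x" "dirichlet_norm x dirichlet_unit = 1"
    unfolding abs_conv_at_def dirichlet_norm_def eq
    using sums_summable[OF *] sums_unique[OF *, symmetric] by auto
  show "dirichlet_sum dirichlet_unit s = 1"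
    unfolding dirichlet_sum_def dirichlet_term_unit
    using sums_unique[OF *, symmetric] by auto
qed

lemma
  assumes "abs_conv_at f x"
  shows abs_conv_at_power: "abs_conv_at (dirichlet_power f k) x"
    and dirichlet_norm_power_le: "dirichlet_norm x (dirichlet_power f k) \<le> dirichlet_norm x f ^ k"
proof -
  have "abs_conv_at (dirichlet_power f k) x \<and> dirichlet_norm x (dirichlet_power f k) \<le> dirichlet_norm x f ^ k"
  proof (induction k)
    case (Suc k)
    then have "dirichlet_norm x (dirichlet_power f (Suc k))
        \<le> dirichlet_norm x f * dirichlet_norm x (dirichlet_power f k)"
      using dirichlet_norm_conv_le[OF assms] by simp
    also have "\<dots> \<le> dirichlet_norm x f * dirichlet_norm x f ^ k"
      using Suc dirichlet_norm_nonneg[OF assms] by (intro mult_left_mono) auto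
    finally show ?case using abs_conv_at_conv[OF assms] Suc by simp
  qed (simp add: abs_conv_at_unit dirichlet_norm_unit)
  then show "abs_conv_at (dirichlet_power f k) x"
    "dirichlet_norm x (dirichlet_power f k) \<le> dirichlet_norm x f ^ k" by auto
qed

lemma dirichlet_sum_power:
  assumes "abs_conv_at f x" "x \<le> Re s"
  shows "dirichlet_sum (dirichlet_power f k) s = dirichlet_sum f s ^ k"
  by (induction k)
     (use assms in \<open>simp_all add: dirichlet_sum_unit dirichlet_sum_conv[OF _ abs_conv_at_power]\<close>)

text \<open>
  Without a coefficient at $n = 1$ every remaining factor $n^{-\sigma}$ decays at least as fast as
  $2^{-\sigma}$.
\<close>

lemma norm_dirichlet_term_decay:
  assumes "f 1 = 0" "x \<le> Re s"
  shows "norm (dirichlet_term f s n) \<le> 2 powr (x - Re s) * norm (dirichlet_term f (of_real x) n)"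
proof (cases "n \<le> 1")
  case True
  then have "n = 0 \<or> n = 1" by auto
  with assms show ?thesis by (auto simp: dirichlet_term_def)
next
  case False
  have "real n powr - Re s = real n powr (x - Re s) * real n powr - x"
    by (simp add: powr_add[symmetric])
  also have "\<dots> \<le> 2 powr (x - Re s) * real n powr - x"
    using False assms by (intro mult_right_mono powr_mono2') auto
  finally show ?thesis
    by (simp add: norm_dirichlet_term mult.left_commute mult_left_mono)
qed

lemma dirichlet_norm_decay:
  assumes "abs_conv_at f x" "f 1 = 0" "x \<le> y"
  shows "dirichlet_norm y f \<le> 2 powr (x - y) * dirichlet_norm x f"
proof -
  have "dirichlet_norm y f \<le> (\<Sum>n. 2 powr (x - y) * norm (dirichlet_term f (of_real x) n))"
    unfolding dirichlet_norm_def
    using assms abs_conv_at_mono[OF assms(1,3)] norm_dirichlet_term_decay[of f x "of_real y"]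
    by (intro suminf_le summable_mult) (auto simp: abs_conv_at_def)
  also have "\<dots> = 2 powr (x - y) * dirichlet_norm x f"
    unfolding dirichlet_norm_def using assms by (intro suminf_mult) (simp add: abs_conv_at_def)
  finally show ?thesis .
qed

lemma abs_conv_at_comparison:
  assumes "abs_conv_at f x" "\<And>n. n > 0 \<Longrightarrow> norm (g n) * real n powr - y \<le> C * (norm (f n) * real n powr - x)"
  shows "abs_conv_at g y"
  unfolding abs_conv_at_def
proof (rule summable_comparison_test')
  show "summable (\<lambda>n. C * norm (dirichlet_term f (of_real x) n))"
    using assms(1) by (intro summable_mult) (simp add: abs_conv_at_def)
  show "norm (norm (dirichlet_term g (of_real y) n)) \<le> C * norm (dirichlet_term f (of_real x) n)"
    if "n \<ge> 0" for n
    using assms(2)[of n] by (cases "n = 0") (auto simp: norm_dirichlet_term)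
qed

text \<open>
  Far enough to the right the terms of $a$ with $n > 1$ add up to at most $|a(1)|$. The recursion that
  defines the Dirichlet inverse $b$ then gives $|a(1)|\,|b(n)| \le n^y$ by induction. The abscissa obtained
  here is not under control; this crude result only provides some half-plane in which the series of an
  inverse may be manipulated.
\<close>

lemma abs_conv_at_inverse:
  assumes a1: "a 1 \<noteq> 0" and ax: "abs_conv_at a x"
  obtains y where "abs_conv_at (dirichlet_inverse a) y"
proof -
  define b where "b = dirichlet_inverse a"
  have b0: "b 0 = 0" and ab: "dirichlet_conv a b = dirichlet_unit"
    using dirichlet_inverse_props[of a] a1 by (auto simp: b_def)
  define f where "f = a(1 := 0)"
  have fx: "abs_conv_at f x"
    by (rule abs_conv_at_comparison[OF ax, where C = 1]) (auto simp: f_def)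
  obtain k where k: "dirichlet_norm x f / norm (a 1) < 2 ^ k"
    using real_arch_pow[of 2 "dirichlet_norm x f / norm (a 1)"] by auto
  \<comment> \<open>Moving k units to the right divides the norm of the terms with n > 1 by at least 2 ^ k.\<close>
  define y where "y = x + real k"
  have "dirichlet_norm y f \<le> 2 powr (x - y) * dirichlet_norm x f"
    by (rule dirichlet_norm_decay[OF fx]) (auto simp: f_def y_def)
  also have "\<dots> = dirichlet_norm x f / 2 ^ k"
    by (simp add: y_def powr_minus powr_realpow field_simps)
  also have "\<dots> \<le> norm (a 1)"
    using k a1 by (simp add: field_simps)
  finally have fy: "dirichlet_norm y f \<le> norm (a 1)" .
  have fy': "abs_conv_at f y"
    using abs_conv_at_mono[OF fx] by (simp add: y_def)
  have bound: "norm (a 1) * norm (b n) \<le> real n powr y" for n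
  proof (induction n rule: less_induct)
    case (less n)
    consider "n = 0" | "n = 1" | "n > 1" by linarith
    then show ?case
    proof cases
      case 2
      have "a 1 * b 1 = 1"
        using fun_cong[OF ab, of 1] by (simp add: dirichlet_unit_def)
      then show ?thesis using 2 by (simp flip: norm_mult)
    next
      case 3
      let ?E = "{d. d dvd n \<and> d \<noteq> 1}"
      have fin: "finite ?E"
        using 3 by (intro finite_subset[OF _ finite_divisors_nat[of n]]) auto
      have "a 1 * b n + (\<Sum>d\<in>?E. a d * b (n div d)) = 0"
        using fun_cong[OF ab, of n] dirichlet_conv_rec[of n a b] 3 by (simp add: dirichlet_unit_def)
      then have "norm (a 1) * norm (b n) = norm (\<Sum>d\<in>?E. a d * b (n div d))"
        by (metis add_eq_0_iff norm_minus_cancel norm_mult)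
      also have "\<dots> \<le> (\<Sum>d\<in>?E. real n powr y / norm (a 1) * norm (dirichlet_term f (of_real y) d))"
      proof (rule sum_norm_le)
        fix d assume d: "d \<in> ?E"
        then have "norm (a 1) * norm (b (n div d)) \<le> real (n div d) powr y"
          using 3 by (intro less.IH) (auto intro!: div_proper_less_nat[simplified])
        also have "real (n div d) powr y = real n powr y * real d powr - y"
          using d 3 by (auto elim!: dvdE simp: powr_mult powr_minus field_simps)
        finally have "norm (b (n div d)) \<le> real n powr y * real d powr - y / norm (a 1)"
          using a1 by (simp add: field_simps)
        then have "norm (a d) * norm (b (n div d)) \<le> norm (a d) * (real n powr y * real d powr - y / norm (a 1))"
          by (rule mult_left_mono) auto
        then show "norm (a d * b (n div d)) \<le> real n powr y / norm (a 1) * norm (dirichlet_term f (of_real y) d)"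
          using d by (simp add: norm_mult norm_dirichlet_term f_def mult_ac)
      qed
      also have "\<dots> = real n powr y / norm (a 1) * (\<Sum>d\<in>?E. norm (dirichlet_term f (of_real y) d))"
        by (simp add: sum_distrib_left)
      also have "\<dots> \<le> real n powr y / norm (a 1) * norm (a 1)"
        using sum_norm_dirichlet_term_le[OF fy' fin] fy by (intro mult_left_mono) auto
      finally show ?thesis using a1 by simp
    qed (use b0 in auto)
  qed
  \<comment> \<open>The exponent 2 makes the sum over n of 1 / n^2 appear.\<close>
  have "abs_conv_at b (y + 2)"
    unfolding abs_conv_at_def
  proof (rule summable_comparison_test')
    show "summable (\<lambda>n. 1 / norm (a 1) * real n powr - 2)"
      by (intro summable_mult) (simp add: summable_real_powr_iff)
    show "norm (norm (dirichlet_term b (of_real (y + 2)) n)) \<le> 1 / norm (a 1) * real n powr - 2"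
      if "n \<ge> 0" for n
    proof (cases "n = 0")
      case False
      have "norm (b n) * real n powr - (y + 2) \<le> real n powr y / norm (a 1) * real n powr - (y + 2)"
        using bound[of n] a1 by (intro mult_right_mono) (auto simp: field_simps)
      also have "\<dots> = 1 / norm (a 1) * (real n powr y * real n powr - (y + 2))"
        by simp
      also have "real n powr y * real n powr - (y + 2) = real n powr - 2"
        by (simp add: powr_add[symmetric])
      finally show ?thesis by (simp add: norm_dirichlet_term)
    qed simp
  qed
  then show ?thesis using that by (simp add: b_def)
qed

section \<open>Differentiation of Dirichlet series\<close>

definition log_mult :: "(nat \<Rightarrow> complex) \<Rightarrow> nat \<Rightarrow> complex" where
  "log_mult f n = f n * of_real (ln (real n))"

lemma abs_conv_at_log_mult:
  assumes "abs_conv_at f x" "x < y"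
  shows "abs_conv_at (log_mult f) y"
proof (rule abs_conv_at_comparison[OF assms(1), where C = "1 / (y - x)"])
  fix n :: nat assume n: "n > 0"
  have "\<bar>ln (real n)\<bar> * real n powr - y \<le> real n powr (y - x) / (y - x) * real n powr - y"
    using n assms ln_powr_bound[of "real n" "y - x"] by (intro mult_right_mono) auto
  also have "\<dots> = 1 / (y - x) * (real n powr (y - x) * real n powr - y)"
    by simp
  also have "real n powr (y - x) * real n powr - y = real n powr - x"
    by (simp add: powr_add[symmetric])
  finally have "norm (f n) * (\<bar>ln (real n)\<bar> * real n powr - y) \<le> norm (f n) * (1 / (y - x) * real n powr - x)"
    by (rule mult_left_mono) auto
  then show "norm (log_mult f n) * real n powr - y \<le> 1 / (y - x) * (norm (f n) * real n powr - x)"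
    by (simp add: log_mult_def norm_mult mult_ac)
qed

lemma has_field_derivative_dirichlet_sum:
  assumes "abs_conv_at f x" "x < Re s"
  shows "(dirichlet_sum f has_field_derivative - dirichlet_sum (log_mult f) s) (at s)"
proof -
  obtain y where y: "x < y" "y < Re s" using dense assms(2) by blast
  have fy: "abs_conv_at f y" and ly: "abs_conv_at (log_mult f) y"
    using y abs_conv_at_mono[OF assms(1)] abs_conv_at_log_mult[OF assms(1)] by auto
  let ?S = "{s. Re s \<ge> y}"
  have "((\<lambda>s. \<Sum>n. dirichlet_term f s n) has_field_derivative
      (\<Sum>n. - dirichlet_term (log_mult f) s n)) (at s)"
  proof (rule has_field_derivative_series'(2))
    show "convex ?S" by (rule convex_halfspace_Re_ge)
    show "s \<in> interior ?S"
      by (rule subsetD[OF interior_maximal[of "{s. Re s > y}"]]) (use y in \<open>auto simp: open_halfspace_Re_gt\<close>)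
    show "of_real y \<in> ?S" by simp
    show "summable (\<lambda>n. dirichlet_term f (of_real y) n)"
      using abs_conv_at_summable[OF fy] by simp
    show "((\<lambda>s. dirichlet_term f s n) has_field_derivative - dirichlet_term (log_mult f) z n) (at z within ?S)"
      for n z
    proof (cases "n = 0")
      case False
      then show ?thesis
        unfolding dirichlet_term_def log_mult_def powr_def
        by (auto intro!: derivative_eq_intros simp: Ln_of_nat)
    qed simp
    show "uniformly_convergent_on ?S (\<lambda>n x. \<Sum>i<n. - dirichlet_term (log_mult f) x i)"
    proof (rule Weierstrass_m_test'_ev)
      show "\<forall>\<^sub>F n in sequentially. \<forall>x\<in>?S.
          norm (- dirichlet_term (log_mult f) x n) \<le> norm (dirichlet_term (log_mult f) (of_real y) n)"
        by (auto intro!: always_eventually norm_dirichlet_term_mono)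
    qed (use ly in \<open>simp add: abs_conv_at_def\<close>)
  qed
  also have "(\<Sum>n. - dirichlet_term (log_mult f) s n) = - dirichlet_sum (log_mult f) s"
    unfolding dirichlet_sum_def using abs_conv_at_summable[OF ly, of s] y by (simp add: suminf_minus)
  finally show ?thesis
    by (simp add: dirichlet_sum_def[abs_def])
qed

lemma holomorphic_on_dirichlet_sum:
  assumes "abs_conv_at f x"
  shows "dirichlet_sum f holomorphic_on {s. Re s > x}"
  using has_field_derivative_dirichlet_sum[OF assms]
  by (auto simp: holomorphic_on_open open_halfspace_Re_gt)

section \<open>Truncation and behaviour far to the right\<close>

definition dirichlet_head :: "nat \<Rightarrow> (nat \<Rightarrow> complex) \<Rightarrow> nat \<Rightarrow> complex" where
  "dirichlet_head N f n = (if n \<le> N then f n else 0)"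

definition dirichlet_tail :: "nat \<Rightarrow> (nat \<Rightarrow> complex) \<Rightarrow> nat \<Rightarrow> complex" where
  "dirichlet_tail N f n = (if n \<le> N then 0 else f n)"

lemma dirichlet_term_head:
  "dirichlet_term (dirichlet_head N f) s n = (if n \<in> {..N} then dirichlet_term f s n else 0)"
  by (simp add: dirichlet_term_def dirichlet_head_def)

lemma abs_conv_at_head: "abs_conv_at (dirichlet_head N f) x"
  unfolding abs_conv_at_def
  by (rule summable_finite[of "{..N}"]) (auto simp: dirichlet_term_head)

lemma dirichlet_sum_head: "dirichlet_sum (dirichlet_head N f) s = (\<Sum>n\<le>N. dirichlet_term f s n)"
  unfolding dirichlet_sum_def
  by (subst suminf_finite[of "{..N}"]) (auto simp: dirichlet_term_head)

lemma abs_conv_at_tail: "abs_conv_at f x \<Longrightarrow> abs_conv_at (dirichlet_tail N f) x"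
  by (erule abs_conv_at_comparison[where C = 1]) (auto simp: dirichlet_tail_def)

lemma dirichlet_sum_split:
  assumes "abs_conv_at f x" "x \<le> Re s"
  shows "dirichlet_sum f s = dirichlet_sum (dirichlet_head N f) s + dirichlet_sum (dirichlet_tail N f) s"
proof -
  have "dirichlet_term f s = (\<lambda>n. dirichlet_term (dirichlet_head N f) s n + dirichlet_term (dirichlet_tail N f) s n)"
    by (auto simp: dirichlet_term_def dirichlet_head_def dirichlet_tail_def)
  then show ?thesis
    unfolding dirichlet_sum_def
    by (metis suminf_add abs_conv_at_summable[OF abs_conv_at_head assms(2)]
        abs_conv_at_summable[OF abs_conv_at_tail[OF assms(1)] assms(2)])
qed

lemma dirichlet_norm_tail_tendsto:
  assumes "abs_conv_at f x"
  shows "(\<lambda>N. dirichlet_norm x (dirichlet_tail N f)) \<longlonglongrightarrow> 0"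
proof -
  let ?t = "\<lambda>n. norm (dirichlet_term f (of_real x) n)"
  have sm: "summable ?t" using assms by (simp add: abs_conv_at_def)
  have "dirichlet_norm x (dirichlet_tail N f) = suminf ?t - (\<Sum>n\<le>N. ?t n)" for N
  proof -
    have 1: "(\<lambda>n. if n \<in> {..N} then ?t n else 0) sums (\<Sum>n\<le>N. ?t n)"
      by (rule sums_If_finite_set) auto
    have "(\<lambda>n. ?t n - (if n \<in> {..N} then ?t n else 0)) sums (suminf ?t - (\<Sum>n\<le>N. ?t n))"
      by (intro sums_diff summable_sums sm 1)
    moreover have "(\<lambda>n. ?t n - (if n \<in> {..N} then ?t n else 0)) =
        (\<lambda>n. norm (dirichlet_term (dirichlet_tail N f) (of_real x) n))"
      by (auto simp: dirichlet_term_def dirichlet_tail_def)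
    ultimately show ?thesis
      unfolding dirichlet_norm_def by (simp add: sums_iff)
  qed
  moreover have "(\<lambda>N. suminf ?t - (\<Sum>n\<le>N. ?t n)) \<longlonglongrightarrow> suminf ?t - suminf ?t"
    by (intro tendsto_intros summable_LIMSEQ' sm)
  ultimately show ?thesis by simp
qed

lemma dirichlet_sum_near_first_coeff:
  assumes "abs_conv_at a x" "\<epsilon> > 0"
  obtains R where "R \<ge> x" "\<And>s. Re s \<ge> R \<Longrightarrow> norm (dirichlet_sum a s - a 1) \<le> \<epsilon>"
proof -
  let ?f = "dirichlet_tail 1 a"
  have fx: "abs_conv_at ?f x" by (rule abs_conv_at_tail[OF assms(1)])
  obtain k where k: "dirichlet_norm x ?f / \<epsilon> < 2 ^ k"
    using real_arch_pow[of 2 "dirichlet_norm x ?f / \<epsilon>"] by auto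
  have "norm (dirichlet_sum a s - a 1) \<le> \<epsilon>" if s: "Re s \<ge> x + real k" for s
  proof -
    have "dirichlet_sum a s - a 1 = dirichlet_sum ?f s"
      using dirichlet_sum_split[OF assms(1), of s 1] s
      by (simp add: dirichlet_sum_head atMost_Suc dirichlet_term_def)
    also have "norm \<dots> \<le> dirichlet_norm (x + real k) ?f"
      using s by (intro norm_dirichlet_sum_le abs_conv_at_mono[OF fx]) auto
    also have "\<dots> \<le> 2 powr (x - (x + real k)) * dirichlet_norm x ?f"
      by (intro dirichlet_norm_decay fx) (auto simp: dirichlet_tail_def)
    also have "\<dots> = dirichlet_norm x ?f / 2 ^ k"
      by (simp add: powr_minus powr_realpow field_simps)
    also have "\<dots> \<le> \<epsilon>" using k assms(2) by (simp add: field_simps)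
    finally show ?thesis .
  qed
  then show ?thesis using that[of "x + real k"] by simp
qed

section \<open>Lower bounds for nonvanishing Dirichlet series\<close>

text \<open>
  A nonvanishing Dirichlet series cannot become small along a sequence of points in a smaller closed
  half-plane. It is close to $a(1)$ far to the right, so such points have bounded real parts. By Montel's
  theorem a subsequence of the corresponding vertical translates converges to a holomorphic $g$; the
  translates have no zeros, so Hurwitz's theorem shows that $g$ is constant or has no zeros, and it is
  not the constant 0 because of its values far to the right. Hence $|g|$ has a positive minimum on the
  compact segment which contains the real parts, a contradiction.
\<close>

lemma dirichlet_sum_bounded_below:
  assumes ac: "\<And>x. x > x0 \<Longrightarrow> abs_conv_at a x" and a1: "a 1 \<noteq> 0"
    and nz: "\<And>s. Re s > x0 \<Longrightarrow> dirichlet_sum a s \<noteq> 0" and y: "y > x0"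
  obtains m where "m > 0" "\<And>s. Re s \<ge> y \<Longrightarrow> m \<le> norm (dirichlet_sum a s)"
proof (rule ccontr)
  assume "\<not> thesis"
  with that have small: "\<exists>s. Re s \<ge> y \<and> norm (dirichlet_sum a s) < m" if "m > 0" for m
    using \<open>m > 0\<close> by (meson not_le)
  have "norm (a 1) / 2 > 0" using a1 by simp
  then obtain R where R: "R \<ge> y" "\<And>s. Re s \<ge> R \<Longrightarrow> norm (dirichlet_sum a s - a 1) \<le> norm (a 1) / 2"
    using dirichlet_sum_near_first_coeff[OF ac[OF y]] by metis
  define c where "c = (\<lambda>n. norm (a 1) / 2 / (real n + 1))"
  have c_pos: "c n > 0" for n using a1 by (simp add: c_def)
  have c_le: "c n \<le> norm (a 1) / 2" for n
    by (simp add: c_def field_simps)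
  have c_lim: "c \<longlonglongrightarrow> 0" unfolding c_def by real_asymp
  have "\<forall>n. \<exists>s. Re s \<ge> y \<and> norm (dirichlet_sum a s) < c n"
    using small c_pos by blast
  then obtain w where w: "\<And>n. Re (w n) \<ge> y" "\<And>n. norm (dirichlet_sum a (w n)) < c n"
    by metis
  have wR: "Re (w n) \<le> R" for n
  proof (rule ccontr)
    assume "\<not> Re (w n) \<le> R"
    then have "norm (dirichlet_sum a (w n) - a 1) \<le> norm (a 1) / 2" by (intro R) auto
    moreover have "norm (a 1) \<le> norm (dirichlet_sum a (w n)) + norm (dirichlet_sum a (w n) - a 1)"
      by (metis norm_triangle_sub norm_minus_commute)
    ultimately show False using w(2)[of n] c_le[of n] by linarith
  qed
  let ?S = "{s. Re s > x0}"
  define F where "F = (\<lambda>n s. dirichlet_sum a (s + \<i> * of_real (Im (w n))))"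
  have hol_a: "dirichlet_sum a holomorphic_on ?S"
  proof -
    have "dirichlet_sum a field_differentiable at s" if "Re s > x0" for s
    proof -
      obtain x where "x0 < x" "x < Re s" using dense \<open>Re s > x0\<close> by blast
      then show ?thesis
        using has_field_derivative_dirichlet_sum[OF ac, of x s] by (auto simp: field_differentiable_def)
    qed
    then show ?thesis
      by (auto simp: holomorphic_on_def intro: field_differentiable_at_within)
  qed
  have hol_F: "F n holomorphic_on ?S" for n
    unfolding F_def
    by (rule holomorphic_on_compose_gen[OF _ hol_a, unfolded o_def]) (auto intro!: holomorphic_intros)
  have bdd: "\<exists>B. \<forall>h\<in>range F. \<forall>z\<in>K. norm (h z) \<le> B" if K: "compact K" "K \<subseteq> ?S" for K
  proof (cases "K = {}")
    case False
    have "compact (Re ` K)" by (intro compact_continuous_image continuous_intros K)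
    then obtain z0 where z0: "z0 \<in> K" "\<And>z. z \<in> K \<Longrightarrow> Re z0 \<le> Re z"
      using compact_attains_inf[of "Re ` K"] False by (metis (no_types, lifting) empty_is_image image_iff)
    then have "abs_conv_at a (Re z0)" using K by (intro ac) auto
    then show ?thesis
      unfolding F_def using norm_dirichlet_sum_le z0 by (intro exI[of _ "dirichlet_norm (Re z0) a"]) auto
  qed auto
  obtain g r where g: "g holomorphic_on ?S" and r: "strict_mono (r :: nat \<Rightarrow> nat)"
    and lim: "\<And>x. x \<in> ?S \<Longrightarrow> (\<lambda>n. F (r n) x) \<longlonglongrightarrow> g x"
    and ul: "\<And>K. compact K \<Longrightarrow> K \<subseteq> ?S \<Longrightarrow> uniform_limit K (F \<circ> r) g sequentially"
    by (rule Montel[OF open_halfspace_Re_gt, of "range F" x0 F]) (use hol_F bdd in auto)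
  have gR: "g (of_real R) \<noteq> 0"
  proof
    assume 0: "g (of_real R) = 0"
    have "(\<lambda>n. norm (F (r n) (of_real R) - a 1)) \<longlonglongrightarrow> norm (g (of_real R) - a 1)"
      using R y by (intro tendsto_intros lim) auto
    then have "norm (g (of_real R) - a 1) \<le> norm (a 1) / 2"
    proof (rule LIMSEQ_le_const2, intro exI allI impI)
      show "norm (F (r n) (of_real R) - a 1) \<le> norm (a 1) / 2" for n
        unfolding F_def by (rule R) simp
    qed
    with 0 a1 show False by simp
  qed
  have g_nz: "g z \<noteq> 0" if z: "z \<in> ?S" for z
  proof (cases "g constant_on ?S")
    case True
    then have "g z = g (of_real R)"
      using z R y unfolding constant_on_def by auto
    with gR show ?thesis by simp
  next
    case False
    show ?thesis
    proof (rule Hurwitz_no_zeros[where \<F> = "F \<circ> r", OF open_halfspace_Re_gt _ _ g _ False _ z])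
      show "connected ?S" by (intro convex_connected convex_halfspace_Re_gt)
      show "(F \<circ> r) n holomorphic_on ?S" for n using hol_F by simp
      show "(F \<circ> r) n u \<noteq> 0" if "u \<in> ?S" for n u
        using that nz by (auto simp: F_def)
      show "uniform_limit K (F \<circ> r) g sequentially" if "compact K" "K \<subseteq> ?S" for K
        by (rule ul[OF that])
    qed
  qed
  \<comment> \<open>The points w n, moved vertically to the real axis, lie in this segment.\<close>
  let ?K = "complex_of_real ` {y..R}"
  have K: "compact ?K" "?K \<subseteq> ?S" "?K \<noteq> {}"
    using y R by (auto intro!: compact_continuous_image continuous_intros)
  have "continuous_on ?K (\<lambda>z. norm (g z))"
    using g K by (intro continuous_intros holomorphic_on_imp_continuous_on) (auto elim: holomorphic_on_subset)
  then obtain z0 where z0: "z0 \<in> ?K" "\<And>z. z \<in> ?K \<Longrightarrow> norm (g z0) \<le> norm (g z)"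
    using continuous_attains_inf[OF K(1,3)] by blast
  define \<delta> where "\<delta> = norm (g z0) / 2"
  have \<delta>: "\<delta> > 0" using g_nz z0 K by (auto simp: \<delta>_def)
  have "\<forall>\<^sub>F n in sequentially. \<forall>z\<in>?K. dist ((F \<circ> r) n z) (g z) < \<delta>"
    using uniform_limitD[OF ul[OF K(1,2)] \<delta>] .
  moreover have "\<forall>\<^sub>F n in sequentially. c (r n) < \<delta>"
    using order_tendstoD(2)[OF LIMSEQ_subseq_LIMSEQ[OF c_lim r] \<delta>] by simp
  ultimately have "\<forall>\<^sub>F n in sequentially. False"
  proof eventually_elim
    case (elim n)
    let ?z = "complex_of_real (Re (w (r n)))"
    have z: "?z \<in> ?K" using w wR by auto
    have "F (r n) ?z = dirichlet_sum a (w (r n))"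
      by (simp add: F_def flip: complex_eq)
    then have "norm (F (r n) ?z) < \<delta>" using w(2)[of "r n"] elim by simp
    moreover have "norm (g ?z) \<le> norm (F (r n) ?z) + dist (F (r n) ?z) (g ?z)"
      by (metis dist_commute dist_norm norm_triangle_sub)
    moreover have "dist (F (r n) ?z) (g ?z) < \<delta>" using elim z by auto
    ultimately show False using z0(2)[OF z] by (simp add: \<delta>_def)
  qed
  then show False by simp
qed

section \<open>Coefficient estimates\<close>

text \<open>
  Comparison of the leading terms of two affine functions; it replaces dividing by the length of a
  vertical segment and letting the length tend to infinity.
\<close>

lemma linear_growth_le:
  fixes A B C :: real
  assumes "\<And>T. T > 0 \<Longrightarrow> A * T \<le> B * T + C"
  shows "A \<le> B"
proof (rule ccontr)
  assume "\<not> A \<le> B"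
  then have pos: "A - B > 0" by simp
  define T where "T = (\<bar>C\<bar> + 1) / (A - B)"
  have "T > 0" using pos by (simp add: T_def)
  moreover have "(A - B) * T = \<bar>C\<bar> + 1" using pos by (simp add: T_def)
  ultimately show False using assms[of T] by (simp add: left_diff_distrib)
qed

text \<open>
  This is the analogue of Cauchy's estimates for Dirichlet series: the bound $M$ holds on a half-plane that may
  be much larger than the one in which the series is known to converge. The coefficient $c(n)$ is the
  mean value of $g(s) = h(s)\,n^s$ on the line $\Re s = k$, where the series converges absolutely: all
  terms of the series other than the $n$-th one oscillate. In terms of a primitive $H$ of $g$, the integral of $g$
  over a vertical segment is a difference of two values of $H$. Moving the segment of length $2 T$ from
  $\Re s = k$ to $\Re s = y$ changes this difference by an amount bounded independently of $T$, and on
  the line $\Re s = y$ it is at most $2 T M n^y$ by the mean value inequality.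
\<close>

lemma dirichlet_coeff_bound:
  assumes hol: "h holomorphic_on {s. Re s > x}"
    and bd: "\<And>s. Re s > x \<Longrightarrow> norm (h s) \<le> M"
    and ac: "abs_conv_at c k" and xk: "x < k"
    and eq: "\<And>s. Re s = k \<Longrightarrow> h s = dirichlet_sum c s"
    and xy: "x < y" and n: "n > 0"
  shows "norm (c n) \<le> M * real n powr y"
proof -
  let ?U = "{s. Re s > x}"
  have M: "M \<ge> 0" using bd[of "of_real y"] xy norm_ge_zero[of "h (of_real y)"] by (simp del: norm_ge_zero)
  define g where "g = (\<lambda>s. h s * of_nat n powr s)"
  have "g holomorphic_on ?U"
    unfolding g_def by (intro holomorphic_intros hol) (use n in auto)
  then obtain H where H: "\<And>s. s \<in> ?U \<Longrightarrow> (H has_field_derivative g s) (at s within ?U)"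
    using holomorphic_convex_primitive'[OF convex_halfspace_Re_gt open_halfspace_Re_gt] by blast
  have ng: "norm (g s) \<le> M * real n powr Re s" if "Re s > x" for s
    using bd[OF that] n by (auto simp: g_def norm_mult norm_powr_real_powr intro!: mult_right_mono)
  define w where "w = max y k"
  have wn: "real n powr t \<le> real n powr w" if "t \<le> w" for t
    using n that by (intro powr_mono) auto
  have horiz: "norm (H p - H q) \<le> M * real n powr w * \<bar>k - y\<bar>"
    if "Re p = y" "Re q = k" "Im p = Im q" for p q
  proof -
    have "norm (H p - H q) \<le> M * real n powr w * norm (p - q)"
    proof (rule field_differentiable_bound[of "closed_segment p q" H g])
      show "convex (closed_segment p q)" by simp
      fix z assume z: "z \<in> closed_segment p q"
      have "Re z \<in> closed_segment (Re p) (Re q)"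
        using z by (auto simp: closed_segment_def) 
      then have Rz: "x < Re z" "Re z \<le> w"
        using that xy xk by (auto simp: closed_segment_eq_real_ivl w_def split: if_splits)
      have sub: "closed_segment p q \<subseteq> ?U"
        using that xy xk by (intro closed_segment_subset convex_halfspace_Re_gt) auto
      show "(H has_field_derivative g z) (at z within closed_segment p q)"
        using H Rz by (intro has_field_derivative_subset[OF _ sub]) auto
      have "norm (g z) \<le> M * real n powr Re z" by (rule ng[OF Rz(1)])
      also have "\<dots> \<le> M * real n powr w" by (intro mult_left_mono wn Rz M)
      finally show "norm (g z) \<le> M * real n powr w" .
    qed auto
    also have "norm (p - q) = \<bar>k - y\<bar>"
      using that by (simp add: cmod_eq_Re abs_minus_commute)
    finally show ?thesis .
  qed
  have vert_Re: "Re z = u" if "z \<in> closed_segment (Complex u T1) (Complex u T2)" for z u T1 T2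
    using that by (auto simp: closed_segment_def left_diff_distrib)
  have vert: "norm (H (Complex y T) - H (Complex y (-T))) \<le> M * real n powr y * (2 * T)" if "T > 0" for T
  proof -
    have "norm (H (Complex y T) - H (Complex y (-T)))
        \<le> M * real n powr y * norm (Complex y T - Complex y (-T))"
    proof (rule field_differentiable_bound[of "closed_segment (Complex y T) (Complex y (-T))" H g])
      fix z assume z: "z \<in> closed_segment (Complex y T) (Complex y (-T))"
      have sub: "closed_segment (Complex y T) (Complex y (-T)) \<subseteq> ?U"
        using vert_Re xy by auto
      show "(H has_field_derivative g z) (at z within closed_segment (Complex y T) (Complex y (-T)))"
        using H z sub by (intro has_field_derivative_subset[OF _ sub]) auto
      show "norm (g z) \<le> M * real n powr y"
        using ng[of z] vert_Re[OF z] xy by simp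
    qed auto
    also have "norm (Complex y T - Complex y (-T)) = 2 * T"
      using that by (simp add: cmod_eq_Im)
    finally show ?thesis .
  qed
  have main: "norm (c n) \<le> dirichlet_norm k (dirichlet_tail N c) * real n powr k + M * real n powr y"
    if N: "N \<ge> n" for N
  proof -
    \<comment> \<open>K is a primitive of the part of the mean value integrand given by the terms m \<le> N with m \<noteq> n; it stays bounded (by B) on the line of integration. The terms m > N contribute at most E per unit length.\<close>
    let ?I = "{..N} - {n}"
    define K where "K = (\<lambda>s. \<Sum>m\<in>?I. dirichlet_term c s m * of_nat n powr s / of_real (ln (real n) - ln (real m)))"
    define E where "E = dirichlet_norm k (dirichlet_tail N c) * real n powr k"
    define B where "B = (\<Sum>m\<in>?I. norm (dirichlet_term c (of_real k) m) * real n powr k / \<bar>ln (real n) - ln (real m)\<bar>)"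
    have dK: "(K has_field_derivative (\<Sum>m\<in>?I. dirichlet_term c s m) * of_nat n powr s) (at s)" for s
    proof -
      have "((\<lambda>s. dirichlet_term c s m * of_nat n powr s / of_real (ln (real n) - ln (real m)))
          has_field_derivative dirichlet_term c s m * of_nat n powr s) (at s)" if m: "m \<in> ?I" for m
      proof (cases "m = 0")
        case False
        then have "ln (real n) \<noteq> ln (real m)" using m n by simp
        then have ne: "complex_of_real (ln (real n)) - of_real (ln (real m)) \<noteq> 0"
          by (metis of_real_eq_iff right_minus_eq)
        have eqm: "dirichlet_term c s m * of_nat n powr s =
            c m * exp (s * (of_real (ln (real n)) - of_real (ln (real m))))" for s
          using n False by (simp add: dirichlet_term_def powr_def Ln_of_nat algebra_simps flip: exp_add)
        show ?thesis
          unfolding eqm using ne by (auto intro!: derivative_eq_intros)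
      qed simp
      then show ?thesis
        unfolding K_def sum_distrib_right by (intro derivative_intros)
    qed
    have nK: "norm (K s) \<le> B" if "Re s = k" for s
      unfolding K_def B_def
      by (rule sum_norm_le) 
         (use that n in \<open>simp add: norm_mult norm_divide norm_dirichlet_term norm_powr_real_powr flip: of_real_diff\<close>)
    have ineq: "norm (c n) * (2 * T) \<le> (E + M * real n powr y) * (2 * T) + (2 * (M * real n powr w * \<bar>k - y\<bar>) + 2 * B)"
      if T: "T > 0" for T
    proof -
      let ?p = "Complex k T" and ?q = "Complex k (-T)"
      define L where "L = (\<lambda>s. H s - c n * s - K s)"
      have "norm (L ?p - L ?q) \<le> E * norm (?p - ?q)"
      proof (rule field_differentiable_bound)
        show "convex (closed_segment ?p ?q)" by simp
        fix z assume z: "z \<in> closed_segment ?p ?q"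
        have Rz: "Re z = k" by (rule vert_Re[OF z])
        have sub: "closed_segment ?p ?q \<subseteq> ?U" using vert_Re xk by auto
        show "(L has_field_derivative g z - c n - (\<Sum>m\<in>?I. dirichlet_term c z m) * of_nat n powr z)
            (at z within closed_segment ?p ?q)"
          unfolding L_def using z sub
          by (auto intro!: derivative_eq_intros has_field_derivative_subset[OF H sub]
              has_field_derivative_at_within[OF dK])
        have "h z = (\<Sum>m\<le>N. dirichlet_term c z m) + dirichlet_sum (dirichlet_tail N c) z"
          using eq[OF Rz] dirichlet_sum_split[OF ac, of z N] Rz by (simp add: dirichlet_sum_head)
        also have "(\<Sum>m\<le>N. dirichlet_term c z m) = dirichlet_term c z n + (\<Sum>m\<in>?I. dirichlet_term c z m)"
          using N by (intro sum.remove) auto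
        finally have "g z = dirichlet_term c z n * of_nat n powr z +
            (\<Sum>m\<in>?I. dirichlet_term c z m) * of_nat n powr z +
            dirichlet_sum (dirichlet_tail N c) z * of_nat n powr z"
          by (simp add: g_def algebra_simps)
        moreover have "dirichlet_term c z n * of_nat n powr z = c n"
          using n by (simp add: dirichlet_term_def powr_minus)
        ultimately have "g z - c n - (\<Sum>m\<in>?I. dirichlet_term c z m) * of_nat n powr z =
            dirichlet_sum (dirichlet_tail N c) z * of_nat n powr z"
          by simp
        also have "norm \<dots> \<le> E"
          unfolding E_def norm_mult using Rz n
          by (intro mult_mono norm_dirichlet_sum_le abs_conv_at_tail ac dirichlet_norm_nonneg)
             (auto simp: norm_powr_real_powr)
        finally show "norm (g z - c n - (\<Sum>m\<in>?I. dirichlet_term c z m) * of_nat n powr z) \<le> E" .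
      qed auto
      also have pq: "norm (?p - ?q) = 2 * T"
        using T by (simp add: cmod_eq_Im)
      finally have L: "norm (L ?p - L ?q) \<le> E * (2 * T)" .
      have "c n * (?p - ?q) = (H ?p - H (Complex y T)) + (H (Complex y T) - H (Complex y (-T)))
          + (H (Complex y (-T)) - H ?q) - (L ?p - L ?q) - K ?p + K ?q"
        by (simp add: L_def algebra_simps)
      then have "norm (c n) * (2 * T) = norm \<dots>"
        using pq by (metis norm_mult)
      also have "\<dots> \<le> norm (H ?p - H (Complex y T)) + norm (H (Complex y T) - H (Complex y (-T)))
          + norm (H (Complex y (-T)) - H ?q) + norm (L ?p - L ?q) + norm (K ?p) + norm (K ?q)"
        by (intro order_trans[OF norm_triangle_ineq] order_trans[OF norm_triangle_ineq4] add_mono order_refl)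
      finally show ?thesis
        using horiz[of "Complex y T" ?p] horiz[of "Complex y (-T)" ?q] vert[OF T] L nK[of ?p] nK[of ?q]
        by (simp add: norm_minus_commute algebra_simps)
    qed
    have "norm (c n) \<le> E + M * real n powr y"
    proof (rule linear_growth_le)
      fix T :: real assume "T > 0"
      then show "norm (c n) * T \<le> (E + M * real n powr y) * T + (2 * (M * real n powr w * \<bar>k - y\<bar>) + 2 * B)"
        using ineq[of "T / 2"] by simp
    qed
    then show ?thesis by (simp add: E_def)
  qed
  have "(\<lambda>N. dirichlet_norm k (dirichlet_tail N c) * real n powr k + M * real n powr y)
      \<longlonglongrightarrow> 0 * real n powr k + M * real n powr y"
    by (intro tendsto_intros dirichlet_norm_tail_tendsto ac)
  then show ?thesis
    using main by (intro LIMSEQ_le_const[of _ _ "norm (c n)"]) auto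
qed

section \<open>Coefficients supported on integers composed of finitely many primes\<close>

definition prime_factors_in :: "nat set \<Rightarrow> nat set" where
  "prime_factors_in P = {n. n > 0 \<and> (\<forall>p. prime p \<and> p dvd n \<longrightarrow> p \<in> P)}"

text \<open>
  The numbers composed of the primes in a finite set form a very sparse set: the sum is the finite Euler
  product $\prod_{p} (1 - p^{-\eta})^{-1}$. The induction splits off the powers of one prime.
\<close>

lemma summable_on_prime_factors_in:
  assumes "finite P" "\<eta> > 0"
  shows "(\<lambda>n. real n powr - \<eta>) summable_on prime_factors_in P"
  using assms(1)
proof (induction P rule: finite_induct)
  case empty
  have "prime_factors_in {} \<subseteq> {1}"
    unfolding prime_factors_in_def using prime_factor_nat by auto
  then show ?case by (meson finite.intros finite_subset summable_on_finite)
next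
  case (insert p P)
  show ?case
  proof (cases "prime p")
    case False
    then have "prime_factors_in (insert p P) = prime_factors_in P"
      by (auto simp: prime_factors_in_def)
    with insert show ?thesis by simp
  next
    case p: True
    let ?f = "\<lambda>(k, m). real (p ^ k * m) powr - \<eta>"
    \<comment> \<open>Each n is a power of p times a number not divisible by p, which lies in the smaller set.\<close>
    let ?j = "\<lambda>n. (multiplicity p n, n div p ^ multiplicity p n)"
    obtain t where t: "((\<lambda>n. real n powr - \<eta>) has_sum t) (prime_factors_in P)"
      using insert.IH by (auto simp: summable_on_def)
    have lt1: "real p powr - \<eta> < 1"
      using prime_gt_1_nat[OF p] assms(2) powr_less_mono[of "-\<eta>" 0 "real p"] by simp
    have sm: "?f summable_on (UNIV \<times> prime_factors_in P)"
    proof (rule summable_on_SigmaI[where g = "\<lambda>k. (real p powr - \<eta>) ^ k * t"])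
      fix k
      have "(real p ^ k) powr - \<eta> = (real p powr - \<eta>) ^ k"
        using prime_gt_0_nat[OF p] by (simp add: powr_power powr_realpow[symmetric] powr_powr mult.commute)
      then show "((\<lambda>m. ?f (k, m)) has_sum (real p powr - \<eta>) ^ k * t) (prime_factors_in P)"
        using has_sum_cmult_right[OF t, of "(real p powr - \<eta>) ^ k"] by (simp add: powr_mult)
    next
      have "summable (\<lambda>k. (real p powr - \<eta>) ^ k)"
        using lt1 by (intro summable_geometric) auto
      then show "(\<lambda>k. (real p powr - \<eta>) ^ k * t) summable_on UNIV"
        by (intro summable_on_cmult_left) (simp add: summable_on_UNIV_nonneg_real_iff)
    qed auto
    have decomp: "p ^ multiplicity p n * (n div p ^ multiplicity p n) = n" for n
      by (simp add: multiplicity_dvd)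
    have inj: "inj_on ?j (prime_factors_in (insert p P))"
      by (rule inj_onI) (metis decomp prod.inject)
    have sub: "?j ` prime_factors_in (insert p P) \<subseteq> UNIV \<times> prime_factors_in P"
    proof clarsimp
      fix n assume n: "n \<in> prime_factors_in (insert p P)"
      then have "n > 0" by (simp add: prime_factors_in_def)
      then have "\<not> p dvd n div p ^ multiplicity p n"
        using p by (intro multiplicity_decompose) auto
      moreover have "n div p ^ multiplicity p n > 0"
        using decomp[of n] \<open>n > 0\<close> by (metis gr0I mult_0_right)
      moreover have "n div p ^ multiplicity p n dvd n"
        by (metis decomp dvd_triv_right)
      ultimately show "n div p ^ multiplicity p n \<in> prime_factors_in P"
        using n dvd_trans unfolding prime_factors_in_def by blast
    qed
    have "?f summable_on ?j ` prime_factors_in (insert p P)"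
      by (rule summable_on_subset_banach[OF sm sub])
    then have "(?f \<circ> ?j) summable_on prime_factors_in (insert p P)"
      using summable_on_reindex[OF inj] by blast
    then show ?thesis
      by (rule summable_on_cong[THEN iffD1, rotated]) (simp only: o_def case_prod_conv decomp)
  qed
qed

text \<open>
  For coefficients that live on a sparse set, a pointwise bound costs only a constant factor when
  it is turned into a bound of the norm slightly further to the right. The constant $C$
  is independent of the coefficients, which is essential when this is applied to all powers of one series.
\<close>

lemma abs_conv_at_prime_factors_in:
  assumes "finite P" "y < z"
  obtains C where "C \<ge> 0"
    "\<And>c M. (\<And>n. n \<notin> prime_factors_in P \<Longrightarrow> c n = 0) \<Longrightarrow> (\<And>n. n > 0 \<Longrightarrow> norm (c n) \<le> M * real n powr y)
      \<Longrightarrow> abs_conv_at c z \<and> dirichlet_norm z c \<le> M * C"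
proof -
  let ?w = "\<lambda>n. if n \<in> prime_factors_in P then real n powr - (z - y) else 0"
  have "?w summable_on UNIV \<longleftrightarrow> (\<lambda>n. real n powr - (z - y)) summable_on prime_factors_in P"
    by (rule summable_on_cong_neutral) auto
  then have w: "summable ?w"
    using summable_on_prime_factors_in[OF assms(1), of "z - y"] assms(2)
      summable_on_UNIV_nonneg_real_iff[of ?w] by simp
  have "abs_conv_at c z \<and> dirichlet_norm z c \<le> M * suminf ?w"
    if c: "\<And>n. n \<notin> prime_factors_in P \<Longrightarrow> c n = 0" "\<And>n. n > 0 \<Longrightarrow> norm (c n) \<le> M * real n powr y"
    for c M
  proof -
    have le: "norm (dirichlet_term c (of_real z) n) \<le> M * ?w n" for n
    proof (cases "n \<in> prime_factors_in P")
      case True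
      then have "n > 0" by (simp add: prime_factors_in_def)
      then have "norm (c n) * real n powr - z \<le> M * real n powr y * real n powr - z"
        by (intro mult_right_mono c) auto
      also have "\<dots> = M * real n powr - (z - y)"
        by (simp add: powr_add[symmetric] mult.assoc)
      finally show ?thesis using True by (simp add: norm_dirichlet_term)
    qed (simp add: c dirichlet_term_def)
    have ac: "abs_conv_at c z"
      unfolding abs_conv_at_def
      by (rule summable_comparison_test'[OF summable_mult[OF w, of M]]) (use le in auto)
    moreover have "dirichlet_norm z c \<le> (\<Sum>n. M * ?w n)"
      unfolding dirichlet_norm_def
      by (intro suminf_le le summable_mult w) (use ac in \<open>simp add: abs_conv_at_def\<close>)
    ultimately show ?thesis by (simp add: suminf_mult[OF w])
  qed
  moreover have "suminf ?w \<ge> 0" by (rule suminf_nonneg[OF w]) auto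
  ultimately show ?thesis using that by blast
qed

lemma prime_factors_in_mult:
  "m \<in> prime_factors_in P \<Longrightarrow> n \<in> prime_factors_in P \<Longrightarrow> m * n \<in> prime_factors_in P"
  by (auto simp: prime_factors_in_def prime_dvd_mult_iff)

lemma dirichlet_conv_supported:
  assumes "\<And>n. n \<notin> prime_factors_in P \<Longrightarrow> f n = 0" "\<And>n. n \<notin> prime_factors_in P \<Longrightarrow> g n = 0"
    and "n \<notin> prime_factors_in P"
  shows "dirichlet_conv f g n = 0"
  unfolding dirichlet_conv_def
proof (rule sum.neutral, clarify)
  fix d assume "d dvd n"
  then have "d \<notin> prime_factors_in P \<or> n div d \<notin> prime_factors_in P"
    using prime_factors_in_mult[of d P "n div d"] assms(3) by auto
  then show "f d * g (n div d) = 0" using assms by auto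
qed

lemma dirichlet_power_supported:
  assumes "\<And>n. n \<notin> prime_factors_in P \<Longrightarrow> f n = 0" "n \<notin> prime_factors_in P"
  shows "dirichlet_power f k n = 0"
  using assms(2)
proof (induction k arbitrary: n)
  case 0
  then have "n \<noteq> 1" by (auto simp: prime_factors_in_def)
  then show ?case by (simp add: dirichlet_unit_def)
qed (auto intro!: dirichlet_conv_supported[of P] assms(1))

lemma dirichlet_inverse_head_supported:
  assumes a1: "a 1 \<noteq> 0" and N: "N \<ge> 1" and n: "n \<notin> prime_factors_in {..N}"
  shows "dirichlet_inverse (dirichlet_head N a) n = 0"
  using n
proof (induction n rule: less_induct)
  case (less n)
  define p where "p = dirichlet_head N a"
  have p1: "p 1 \<noteq> 0" using a1 N by (simp add: p_def dirichlet_head_def)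
  note q = dirichlet_inverse_props[of p, OF p1]
  show ?case
  proof (cases "n = 0")
    case True
    then show ?thesis using q(1) by (simp add: p_def)
  next
    case False
    have "n \<noteq> 1" using less.prems by (auto simp: prime_factors_in_def)
    have "p d * dirichlet_inverse p (n div d) = 0" if d: "d dvd n" "d \<noteq> 1" for d
    proof (cases "d \<le> N")
      case True
      have "d > 0" using d False by (auto intro: Nat.gr0I)
      then have "d \<in> prime_factors_in {..N}"
        using True by (auto simp: prime_factors_in_def dest: dvd_imp_le)
      then have "n div d \<notin> prime_factors_in {..N}"
        using prime_factors_in_mult[of d "{..N}" "n div d"] d less.prems by auto
      then have "dirichlet_inverse p (n div d) = 0"
        unfolding p_def using False d by (intro less.IH) (auto intro!: div_proper_less_nat[simplified])
      then show ?thesis by simp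
    qed (simp add: p_def dirichlet_head_def)
    then have "(\<Sum>d | d dvd n \<and> d \<noteq> 1. p d * dirichlet_inverse p (n div d)) = 0"
      by (intro sum.neutral) auto
    then have "p 1 * dirichlet_inverse p n = 0"
      using fun_cong[OF q(2), of n] dirichlet_conv_rec[of n p "dirichlet_inverse p"] False \<open>n \<noteq> 1\<close>
      by (simp add: dirichlet_unit_def)
    then show ?thesis using p1 by (simp add: p_def)
  qed
qed

section \<open>Absolute convergence of the reciprocal\<close>

text \<open>
  The geometric series $1 / (p + e) = \sum_j (-1)^j e^j / p^{j+1}$ for coefficients. With $q = p^{-1}$ and
  $t = q * e$ the inverse $b$ of $a = p + e$ satisfies $b = q - t * b$, and this equation is iterated. Since
  $t(1) = 0$, convolution with $t$ pushes the support of the remainder to the right, so that each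
  coefficient is a finite sum and no convergence is involved.
\<close>

lemma dirichlet_neumann_expansion:
  assumes a: "\<And>n. a n = p n + e n" and e1: "e 1 = 0"
    and pq: "dirichlet_conv p q = dirichlet_unit" and q0: "q 0 = 0"
    and ab: "dirichlet_conv a b = dirichlet_unit" and b0: "b 0 = 0"
    and "n \<le> K"
  shows "b n = (\<Sum>j<K. (- 1) ^ j * dirichlet_conv (dirichlet_power q (Suc j)) (dirichlet_power e j) n)"
proof -
  define t where "t = dirichlet_conv q e"
  define u where "u = (\<lambda>j. dirichlet_conv (dirichlet_power q (Suc j)) (dirichlet_power e j))"
  define r where "r = (\<lambda>K n. b n - (\<Sum>j<K. (- 1) ^ j * u j n))"
  have u0: "u 0 = q"
    using q0 by (simp add: u_def dirichlet_conv_unit_right)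
  have u_Suc: "dirichlet_conv t (u j) = u (Suc j)" for j
    by (simp add: u_def t_def dirichlet_conv_ac)
  have tb: "dirichlet_conv t b n = q n - b n" for n
  proof -
    have "q = dirichlet_conv (dirichlet_conv q a) b"
      using q0 by (simp add: dirichlet_conv_assoc ab dirichlet_conv_unit_right)
    also have "dirichlet_conv q a = (\<lambda>n. dirichlet_unit n + t n)"
    proof
      fix n
      have "a = (\<lambda>n. p n + e n)"
        using a by auto
      then have "dirichlet_conv q a n = dirichlet_conv (\<lambda>n. p n + e n) q n"
        by (metis dirichlet_conv_commute)
      also have "\<dots> = dirichlet_unit n + dirichlet_conv e q n"
        by (simp add: dirichlet_conv_add_left pq)
      also have "dirichlet_conv e q = t"
        unfolding t_def by (rule dirichlet_conv_commute)
      finally show "dirichlet_conv q a n = dirichlet_unit n + t n" .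
    qed
    finally have "q n = dirichlet_conv dirichlet_unit b n + dirichlet_conv t b n"
      by (metis dirichlet_conv_add_left)
    also have "dirichlet_conv dirichlet_unit b n = b n"
      using b0 by (simp add: dirichlet_conv_commute[of dirichlet_unit] dirichlet_conv_unit_right)
    finally show ?thesis by simp
  qed
  have r_Suc: "r (Suc K) n = - dirichlet_conv t (r K) n" for K n
  proof -
    have "dirichlet_conv t (r K) n = q n - b n - (\<Sum>j<K. (- 1) ^ j * u (Suc j) n)"
      unfolding r_def
      by (simp add: dirichlet_conv_diff_right dirichlet_conv_sum_right dirichlet_conv_cmult_right tb u_Suc)
    also have "\<dots> = - r (Suc K) n"
      by (simp add: r_def sum.lessThan_Suc_shift u0 sum_negf del: sum.lessThan_Suc)
    finally show ?thesis by simp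
  qed
  have "r K n = 0" if "n \<le> K" for n K
    using that
  proof (induction K arbitrary: n)
    case 0
    then show ?case by (simp add: r_def b0)
  next
    case (Suc K)
    have "dirichlet_conv t (r K) n = 0"
    proof (cases "n = 0")
      case False
      have "t d * r K (n div d) = 0" if d: "d dvd n" for d
      proof (cases "d = 1")
        case True
        then show ?thesis using e1 by (simp add: t_def)
      next
        case d1: False
        have "n div d < n"
          using False d d1 by (intro div_proper_less_nat) auto
        then show ?thesis using Suc by simp
      qed
      then show ?thesis unfolding dirichlet_conv_def by (intro sum.neutral) auto
    qed simp
    then show ?case by (simp add: r_Suc)
  qed
  from this[OF \<open>n \<le> K\<close>] show ?thesis by (simp add: r_def u_def)
qed

text \<open>
  This is the analogue of Wiener's lemma for Dirichlet series, with a small loss in the abscissa (Hewitt and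
  Williamson). Write $a = p + e$ with a Dirichlet polynomial $p$ such that the norm of $e$ is less than $m/3$. Then
  $|p(s)| \ge 2m/3$ on the half-plane, hence $1/p^j$ is bounded by $(3/(2m))^j$. The coefficients of
  $1/p^j$ are bounded accordingly and supported on the integers whose prime factors are bounded by the length of $p$,
  so the norms of $1/p^j$ are at most $C\,(3/(2m))^j$ with a constant $C$ that does not depend on $j$.
  Therefore the $j$-th term of the expansion $1/a = \sum_j (-e)^j/p^{j+1}$ has norm $O(2^{-j})$.
\<close>

theorem abs_conv_at_inverse_if_bounded_below:
  assumes a1: "a 1 \<noteq> 0" and ax: "abs_conv_at a x" and m: "m > 0"
    and lower: "\<And>s. Re s > x \<Longrightarrow> m \<le> norm (dirichlet_sum a s)" and xz: "x < z"
  shows "abs_conv_at (dirichlet_inverse a) z"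
proof -
  define b where "b = dirichlet_inverse a"
  have b0: "b 0 = 0" and ab: "dirichlet_conv a b = dirichlet_unit"
    using dirichlet_inverse_props[of a] a1 by (auto simp: b_def)
  have "\<forall>\<^sub>F N in sequentially. N \<ge> 1 \<and> dirichlet_norm x (dirichlet_tail N a) < m / 3"
    using order_tendstoD(2)[OF dirichlet_norm_tail_tendsto[OF ax], of "m / 3"] m
      eventually_ge_at_top[of "1::nat"] by (auto intro: eventually_conj)
  then obtain N where N: "N \<ge> 1" and tail: "dirichlet_norm x (dirichlet_tail N a) < m / 3"
    by (auto dest: eventually_happens)
  define p where "p = dirichlet_head N a"
  define e where "e = dirichlet_tail N a"
  define q where "q = dirichlet_inverse p"
  have p1: "p 1 \<noteq> 0" using a1 N by (simp add: p_def dirichlet_head_def)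
  have q0: "q 0 = 0" and pq: "dirichlet_conv p q = dirichlet_unit"
    using dirichlet_inverse_props[of p] p1 by (auto simp: q_def)
  have ex: "abs_conv_at e x" unfolding e_def by (rule abs_conv_at_tail[OF ax])
  have p_lower: "2 * m / 3 \<le> norm (dirichlet_sum p s)" if "Re s > x" for s
  proof -
    have "norm (dirichlet_sum a s) \<le> norm (dirichlet_sum p s) + norm (dirichlet_sum e s)"
      using dirichlet_sum_split[OF ax, of s N] that norm_triangle_ineq by (simp add: p_def e_def)
    moreover have "norm (dirichlet_sum e s) \<le> dirichlet_norm x e"
      using that by (intro norm_dirichlet_sum_le ex) auto
    ultimately show ?thesis using lower[OF that] tail by (simp add: e_def)
  qed
  have px: "abs_conv_at p y" for y unfolding p_def by (rule abs_conv_at_head)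
  \<comment> \<open>The abscissa k0 depends on N; it only serves to identify the coefficients of 1 / p^j.\<close>
  obtain k0 where k0: "abs_conv_at q k0"
    using abs_conv_at_inverse[OF p1 px[of 0]] unfolding q_def by blast
  define k where "k = max k0 (x + 1)"
  have qk: "abs_conv_at q k" and xk: "x < k"
    using abs_conv_at_mono[OF k0] by (auto simp: k_def)
  obtain y where y: "x < y" "y < z" using dense[OF xz] by blast
  define M where "M = 3 / (2 * m)"
  have M: "M > 0" using m by (simp add: M_def)
  have coeff: "norm (dirichlet_power q j n) \<le> M ^ j * real n powr y" if "n > 0" for j n
  proof (rule dirichlet_coeff_bound[where h = "\<lambda>s. (1 / dirichlet_sum p s) ^ j" and x = x and k = k])
    have nz: "dirichlet_sum p s \<noteq> 0" if "Re s > x" for s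
      using p_lower[OF that] m by auto
    then show "(\<lambda>s. (1 / dirichlet_sum p s) ^ j) holomorphic_on {s. Re s > x}"
      by (intro holomorphic_intros holomorphic_on_dirichlet_sum px) auto
    show "norm ((1 / dirichlet_sum p s) ^ j) \<le> M ^ j" if "Re s > x" for s
    proof -
      have "1 / norm (dirichlet_sum p s) \<le> M"
        using p_lower[OF that] m nz[OF that] by (simp add: M_def field_simps)
      then show ?thesis
        by (simp add: norm_power norm_divide power_mono)
    qed
    show "abs_conv_at (dirichlet_power q j) k" by (rule abs_conv_at_power[OF qk])
    show "(1 / dirichlet_sum p s) ^ j = dirichlet_sum (dirichlet_power q j) s" if "Re s = k" for s
    proof -
      have "dirichlet_sum p s * dirichlet_sum q s = 1"
        using dirichlet_sum_conv[OF px qk, of s] that by (simp add: pq dirichlet_sum_unit)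
      moreover have "dirichlet_sum p s \<noteq> 0" using nz[of s] that xk by simp
      ultimately have "dirichlet_sum q s = 1 / dirichlet_sum p s"
        by (simp add: field_simps)
      then show ?thesis using dirichlet_sum_power[OF qk, of s] that by simp
    qed
  qed (use xk y that in auto)
  have supp: "dirichlet_power q j n = 0" if "n \<notin> prime_factors_in {..N}" for j n
    using dirichlet_power_supported[OF _ that, of q]
      dirichlet_inverse_head_supported[of a, OF a1 N] by (simp add: q_def p_def)
  obtain C where C: "C \<ge> 0" and smooth:
    "\<And>c M. (\<And>n. n \<notin> prime_factors_in {..N} \<Longrightarrow> c n = 0) \<Longrightarrow> (\<And>n. n > 0 \<Longrightarrow> norm (c n) \<le> M * real n powr y)
      \<Longrightarrow> abs_conv_at c z \<and> dirichlet_norm z c \<le> M * C"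
    using abs_conv_at_prime_factors_in[OF finite_atMost y(2)] by metis
  have qz: "abs_conv_at (dirichlet_power q j) z" and q_norm: "dirichlet_norm z (dirichlet_power q j) \<le> M ^ j * C" for j
    using smooth[OF supp coeff] by auto
  have ez: "abs_conv_at e z" using abs_conv_at_mono[OF ex] xz by simp
  have e_norm: "dirichlet_norm z e \<le> m / 3"
    using dirichlet_norm_mono[OF ex, of z] tail xz by (simp add: e_def)
  define u where "u = (\<lambda>j. dirichlet_conv (dirichlet_power q (Suc j)) (dirichlet_power e j))"
  have uz: "abs_conv_at (u j) z" for j
    unfolding u_def by (intro abs_conv_at_conv qz abs_conv_at_power[OF ez])
  have u_norm: "dirichlet_norm z (u j) \<le> M * C * (1 / 2) ^ j" for j
  proof -
    have "dirichlet_norm z (u j) \<le> dirichlet_norm z (dirichlet_power q (Suc j)) * dirichlet_norm z (dirichlet_power e j)"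
      unfolding u_def by (rule dirichlet_norm_conv_le[OF qz abs_conv_at_power[OF ez]])
    also have "\<dots> \<le> (M ^ Suc j * C) * (m / 3) ^ j"
    proof (rule mult_mono[OF q_norm])
      show "dirichlet_norm z (dirichlet_power e j) \<le> (m / 3) ^ j"
        using dirichlet_norm_power_le[OF ez, of j] power_mono[OF e_norm dirichlet_norm_nonneg[OF ez], of j]
        by linarith
    qed (use M C in \<open>auto intro: dirichlet_norm_nonneg abs_conv_at_power[OF ez]\<close>)
    also have "\<dots> = M * C * (M * (m / 3)) ^ j"
      by (simp only: power_mult_distrib power_Suc mult_ac)
    also have "M * (m / 3) = 1 / 2" using m by (simp add: M_def)
    finally show ?thesis .
  qed
  have expansion: "b n = (\<Sum>j<K. (- 1) ^ j * u j n)" if "n \<le> K" for n K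
    unfolding u_def
    by (rule dirichlet_neumann_expansion[of a p e, OF _ _ pq q0 ab b0 that])
       (use N in \<open>auto simp: p_def e_def dirichlet_head_def dirichlet_tail_def\<close>)
  \<comment> \<open>For n < K, the first K terms of the expansion determine b n exactly.\<close>
  have "(\<Sum>n<K. norm (dirichlet_term b (of_real z) n)) \<le> M * C * 2" for K
  proof -
    have "(\<Sum>n<K. norm (dirichlet_term b (of_real z) n))
        \<le> (\<Sum>n<K. \<Sum>j<K. norm (dirichlet_term (u j) (of_real z) n))"
    proof (rule sum_mono)
      fix n assume "n \<in> {..<K}"
      then have "dirichlet_term b (of_real z) n = (\<Sum>j<K. (- 1) ^ j * dirichlet_term (u j) (of_real z) n)"
        using expansion[of n K] by (simp add: dirichlet_term_def sum_distrib_right mult.assoc)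
      also have "norm \<dots> \<le> (\<Sum>j<K. norm (dirichlet_term (u j) (of_real z) n))"
        by (rule sum_norm_le) (simp add: norm_mult norm_power)
      finally show "norm (dirichlet_term b (of_real z) n) \<le> \<dots>" .
    qed
    also have "\<dots> = (\<Sum>j<K. \<Sum>n<K. norm (dirichlet_term (u j) (of_real z) n))"
      by (rule sum.swap)
    also have "\<dots> \<le> (\<Sum>j<K. M * C * (1 / 2) ^ j)"
      by (intro sum_mono order_trans[OF sum_norm_dirichlet_term_le u_norm] uz) auto
    also have "\<dots> = M * C * (\<Sum>j<K. (1 / 2) ^ j)"
      by (simp add: sum_distrib_left)
    also have "\<dots> \<le> M * C * 2"
    proof (rule mult_left_mono)
      have "(\<Sum>j<K. (1 / 2 :: real) ^ j) \<le> (\<Sum>j. (1 / 2) ^ j)"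
        by (intro sum_le_suminf summable_geometric) auto
      then show "(\<Sum>j<K. (1 / 2 :: real) ^ j) \<le> 2" by (simp add: suminf_geometric)
    qed (use M C in auto)
    finally show ?thesis .
  qed
  then have "abs_conv_at b z"
    unfolding abs_conv_at_def by (intro summableI_nonneg_bounded[where x = "M * C * 2"]) auto
  then show ?thesis by (simp add: b_def)
qed

section \<open>The logarithm of a Dirichlet series\<close>

lemma dirichlet_sum_tendsto_first_coeff:
  assumes "abs_conv_at f x"
  shows "((\<lambda>t. dirichlet_sum f (of_real t)) \<longlongrightarrow> f 1) at_top"
proof (rule tendstoI)
  fix \<epsilon> :: real assume "\<epsilon> > 0"
  then obtain R where R: "\<And>s. Re s \<ge> R \<Longrightarrow> norm (dirichlet_sum f s - f 1) \<le> \<epsilon> / 2"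
    using dirichlet_sum_near_first_coeff[OF assms, of "\<epsilon> / 2"] by auto
  have "dist (dirichlet_sum f (of_real t)) (f 1) < \<epsilon>" if "t \<ge> R" for t
    using R[of "of_real t"] that \<open>\<epsilon> > 0\<close> by (simp add: dist_norm)
  then show "\<forall>\<^sub>F t in at_top. dist (dirichlet_sum f (of_real t)) (f 1) < \<epsilon>"
    using eventually_at_top_linorder by blast
qed

lemma log_coeff_1: "log_coeff a (Suc 0) = 0"
  by (simp add: log_coeff_def)

lemma log_mult_G_coeff: "log_mult (G_coeff a) = log_coeff a"
proof
  fix n :: nat
  consider "n = 0" | "n = 1" | "n > 1" by linarith
  then show "log_mult (G_coeff a) n = log_coeff a n"
    by cases (auto simp: log_mult_def G_coeff_def log_coeff_1 log_coeff_def)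
qed

lemma log_coeff_eq: "log_coeff a = dirichlet_conv (log_mult a) (dirichlet_inverse a)"
  by (simp add: log_coeff_def log_mult_def[abs_def])

lemma log_coeff_conv:
  assumes "a 1 \<noteq> 0"
  shows "dirichlet_conv (log_coeff a) a = log_mult a"
proof -
  have "dirichlet_conv (log_coeff a) a = dirichlet_conv (log_mult a) (dirichlet_conv a (dirichlet_inverse a))"
    by (simp add: log_coeff_eq dirichlet_conv_ac)
  also have "\<dots> = log_mult a"
    using dirichlet_inverse_props[of a] assms dirichlet_conv_unit_right[of "log_mult a"]
    by (simp add: log_mult_def)
  finally show ?thesis .
qed

lemma abs_conv_at_G_coeff:
  assumes "abs_conv_at (log_coeff a) x"
  shows "abs_conv_at (G_coeff a) x"
proof (rule abs_conv_at_comparison[OF assms, where C = "1 / ln 2"])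
  fix n :: nat assume "n > 0"
  show "norm (G_coeff a n) * real n powr - x \<le> 1 / ln 2 * (norm (log_coeff a n) * real n powr - x)"
  proof (cases "n = 1")
    case False
    then have "ln 2 \<le> ln (real n)" using \<open>n > 0\<close> by simp
    then have "norm (log_coeff a n) / ln (real n) \<le> norm (log_coeff a n) / ln 2"
      using \<open>n > 0\<close> by (intro divide_left_mono) auto
    then have "norm (G_coeff a n) \<le> 1 / ln 2 * norm (log_coeff a n)"
      using \<open>n > 0\<close> by (simp add: G_coeff_def norm_divide)
    then show ?thesis
      using mult_right_mono[of "norm (G_coeff a n)" "1 / ln 2 * norm (log_coeff a n)" "real n powr - x"]
      by (simp add: mult.assoc)
  qed (simp add: G_coeff_def)
qed

text \<open>
  Both sides have the same logarithmic derivative: differentiation multiplies the $n$-th coefficient by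
  $-\log n$, so the derivative of the series with coefficients $A(n)/\log n$ has coefficients $-A(n)$, and
  $A * a = a^{\#}$. So the quotient of the two sides is constant, and the limit $\sigma \to \infty$ shows that the constant is 1.
\<close>

lemma dirichlet_sum_eq_exp:
  assumes a1: "a 1 \<noteq> 0" and ax: "abs_conv_at a x" and gx: "abs_conv_at (G_coeff a) x" and s: "Re s > x"
  shows "dirichlet_sum a s = exp (Ln (a 1) + dirichlet_sum (G_coeff a) s)"
proof -
  let ?U = "{s. Re s > x}"
  define E where "E = (\<lambda>s. dirichlet_sum a s * exp (- dirichlet_sum (G_coeff a) s))"
  have "(E has_field_derivative 0) (at w within ?U)" if w: "w \<in> ?U" for w
  proof -
    obtain y where y: "x < y" "y < Re w" using w dense by blast
    have "abs_conv_at (log_coeff a) y"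
      using abs_conv_at_log_mult[OF gx y(1)] by (simp add: log_mult_G_coeff)
    moreover have "abs_conv_at a y" using abs_conv_at_mono[OF ax] y by simp
    ultimately have *: "dirichlet_sum (log_mult a) w = dirichlet_sum (log_coeff a) w * dirichlet_sum a w"
      using dirichlet_sum_conv[of "log_coeff a" y a w] y log_coeff_conv[of a] a1 by simp
    have da: "(dirichlet_sum a has_field_derivative - dirichlet_sum (log_mult a) w) (at w)"
      using w by (intro has_field_derivative_dirichlet_sum[OF ax]) simp
    have dg: "(dirichlet_sum (G_coeff a) has_field_derivative - dirichlet_sum (log_coeff a) w) (at w)"
      using w has_field_derivative_dirichlet_sum[OF gx] by (simp add: log_mult_G_coeff)
    have "(E has_field_derivative 0) (at w)"
      unfolding E_def
      by (rule derivative_eq_intros da dg refl)+ (simp add: * algebra_simps)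
    then show ?thesis by (rule has_field_derivative_at_within)
  qed
  then obtain c where c: "\<And>w. w \<in> ?U \<Longrightarrow> E w = c"
    using has_field_derivative_zero_constant[OF convex_halfspace_Re_gt, of x E] by blast
  have "((\<lambda>t. E (of_real t)) \<longlongrightarrow> a 1 * exp (- G_coeff a 1)) at_top"
    unfolding E_def by (intro tendsto_intros dirichlet_sum_tendsto_first_coeff[OF ax]
        dirichlet_sum_tendsto_first_coeff[OF gx])
  moreover have "((\<lambda>t. E (of_real t)) \<longlongrightarrow> c) at_top"
    by (intro tendsto_eventually eventually_mono[OF eventually_gt_at_top[of x]] c) simp
  ultimately have "c = a 1"
    using tendsto_unique[OF trivial_limit_at_top_linorder] by (force simp: G_coeff_def)
  with c[of s] s have "a 1 = dirichlet_sum a s * exp (- dirichlet_sum (G_coeff a) s)"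
    by (simp add: E_def)
  then have "a 1 * exp (dirichlet_sum (G_coeff a) s) = dirichlet_sum a s"
    by (simp add: exp_minus)
  then show ?thesis using a1 by (simp add: exp_add)
qed

lemma dirichlet_series_eq_dirichlet_sum:
  assumes "abs_conv_at f x" "x \<le> Re s"
  shows "dirichlet_series f s = dirichlet_sum f s"
  using suminf_split_head[OF abs_conv_at_summable[OF assms]]
  by (simp add: dirichlet_series_def dirichlet_sum_def)

lemma dirichlet_term_G_coeff_1: "dirichlet_term (G_coeff a) s (Suc 0) = 0"
  by (simp add: dirichlet_term_def G_coeff_def)

lemma suminf_G_terms:
  assumes "abs_conv_at (G_coeff a) x" "x \<le> Re s"
  shows "(\<Sum>n. dirichlet_term (G_coeff a) s (n + 2)) = dirichlet_sum (G_coeff a) s"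
  using suminf_minus_initial_segment[OF abs_conv_at_summable[OF assms], of 2]
  by (simp add: dirichlet_sum_def dirichlet_term_G_coeff_1 numeral_2_eq_2)

lemma uniform_limit_dirichlet_sum:
  assumes "abs_conv_at f x" "\<And>s. s \<in> K \<Longrightarrow> x \<le> Re s"
  shows "uniform_limit K (\<lambda>N s. \<Sum>n<N. dirichlet_term f s n) (dirichlet_sum f) sequentially"
  unfolding dirichlet_sum_def[abs_def]
  by (rule Weierstrass_m_test[where M = "\<lambda>n. norm (dirichlet_term f (of_real x) n)"])
     (use assms norm_dirichlet_term_mono in \<open>auto simp: abs_conv_at_def\<close>)

theorem lemma2p7:
  fixes a :: "nat \<Rightarrow> complex" and \<sigma>0 :: real
  assumes "a 1 \<noteq> 0"
    and "\<And>s. Re s > 1 \<Longrightarrow> summable (\<lambda>n. norm (dirichlet_term a s (n + 1)))"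
    and "\<sigma>0 \<ge> 1"
    and "\<And>s. Re s > \<sigma>0 \<Longrightarrow> dirichlet_series a s \<noteq> 0"
  shows "(\<forall>s. Re s > \<sigma>0 \<longrightarrow> dirichlet_series a s = exp (dirichlet_G a s))
    \<and> (\<forall>K. compact K \<and> K \<subseteq> {s. Re s > \<sigma>0} \<longrightarrow>
         uniform_limit K (\<lambda>N s. \<Sum>n=2..N. dirichlet_term (G_coeff a) s n)
           (\<lambda>s. \<Sum>n. dirichlet_term (G_coeff a) s (n + 2)) sequentially)
    \<and> (\<forall>s. Re s > 1 + \<sigma>0 \<longrightarrow>
         summable (\<lambda>n. norm (dirichlet_term (G_coeff a) s (n + 2))))"
proof -
  have ac: "abs_conv_at a x" if "x > \<sigma>0" for x
    using assms(2)[of "of_real x"] assms(3) that summable_Suc_iff[of "\<lambda>n. norm (dirichlet_term a (of_real x) n)"]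
    by (simp add: abs_conv_at_def)
  have nz: "dirichlet_sum a s \<noteq> 0" if "Re s > \<sigma>0" for s
    using assms(4)[OF that] dirichlet_series_eq_dirichlet_sum[OF ac[OF that], of s] by simp
  \<comment> \<open>The abscissa x leaves room on both sides: the lower bound needs x > \<sigma>0, and passing to the inverse and multiplying by log n need x < z.\<close>
  have gc: "abs_conv_at (G_coeff a) z" if z: "z > \<sigma>0" for z
  proof -
    obtain x where x: "\<sigma>0 < x" "x < z" using dense z by blast
    obtain m where m: "m > 0" "\<And>s. Re s \<ge> x \<Longrightarrow> m \<le> norm (dirichlet_sum a s)"
      using dirichlet_sum_bounded_below[of \<sigma>0 a, OF ac assms(1) nz x(1)] by blast
    have "abs_conv_at (dirichlet_inverse a) z"
      by (rule abs_conv_at_inverse_if_bounded_below[OF assms(1) ac[OF x(1)] m(1) m(2) x(2)]) simp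
    moreover have "abs_conv_at (log_mult a) z"
      by (rule abs_conv_at_log_mult[OF ac[OF x(1)] x(2)])
    ultimately have "abs_conv_at (log_coeff a) z"
      unfolding log_coeff_eq by (intro abs_conv_at_conv)
    then show ?thesis by (rule abs_conv_at_G_coeff)
  qed
  have "dirichlet_series a s = exp (dirichlet_G a s)" if s: "Re s > \<sigma>0" for s
  proof -
    obtain x where x: "\<sigma>0 < x" "x < Re s" using dense s by blast
    then show ?thesis
      using dirichlet_sum_eq_exp[of a, OF assms(1) ac[OF x(1)] gc[OF x(1)] x(2)]
        dirichlet_series_eq_dirichlet_sum[OF ac[OF x(1)], of s] suminf_G_terms[OF gc[OF x(1)], of s]
      by (simp add: dirichlet_G_def)
  qed
  moreover have "uniform_limit K (\<lambda>N s. \<Sum>n=2..N. dirichlet_term (G_coeff a) s n)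
      (\<lambda>s. \<Sum>n. dirichlet_term (G_coeff a) s (n + 2)) sequentially"
    if K: "compact K" "K \<subseteq> {s. Re s > \<sigma>0}" for K
  proof (cases "K = {}")
    case False
    have "compact (Re ` K)" by (intro compact_continuous_image continuous_intros K)
    then obtain w where w: "w \<in> K" "\<And>z. z \<in> K \<Longrightarrow> Re w \<le> Re z"
      using compact_attains_inf[of "Re ` K"] False by (metis (no_types, lifting) empty_is_image image_iff)
    have gw: "abs_conv_at (G_coeff a) (Re w)" using gc w K by auto
    have "uniform_limit K (\<lambda>N s. \<Sum>n<Suc N. dirichlet_term (G_coeff a) s n) (dirichlet_sum (G_coeff a)) sequentially"
      by (rule filterlim_compose[OF uniform_limit_dirichlet_sum[OF gw w(2)] filterlim_Suc])
    moreover have "(\<Sum>n<Suc N. dirichlet_term (G_coeff a) s n) = (\<Sum>n=2..N. dirichlet_term (G_coeff a) s n)" for N s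
    proof (rule sum.mono_neutral_right)
      show "\<forall>i\<in>{..<Suc N} - {2..N}. dirichlet_term (G_coeff a) s i = 0"
      proof
        fix i assume "i \<in> {..<Suc N} - {2..N}"
        then have "i = 0 \<or> i = Suc 0" by auto
        then show "dirichlet_term (G_coeff a) s i = 0" by (auto simp: dirichlet_term_G_coeff_1)
      qed
    qed auto
    ultimately show ?thesis
      by (rule uniform_limit_cong'[THEN iffD1, rotated 2]) (use suminf_G_terms[OF gw] w(2) in auto)
  qed simp
  moreover have "summable (\<lambda>n. norm (dirichlet_term (G_coeff a) s (n + 2)))" if "Re s > 1 + \<sigma>0" for s
  proof -
    have "summable (\<lambda>n. norm (dirichlet_term (G_coeff a) s n))"
      using gc[of "Re s"] that by (intro abs_conv_at_summable_norm[where x = "Re s"]) auto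
    then show ?thesis by (rule summable_ignore_initial_segment)
  qed
  ultimately show ?thesis by blast
qed

end
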